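(* Let $d\ge 1$, $\lambda=\frac{d-1}2$, let $\mu$ be a finite signed Borel measure on $\mathbb S^d$ with total mass $\mu(\mathbb S^d)=1$, let $F\in\Phi_d$, and let $f\in L^2_{w_\lambda}[-1,1]$ be such that $$F(x\cdot y)=\int_{\mathbb S^d}f(x\cdot z)f(z\cdot y)\,d\sigma(z),\qquad x,y\in\mathbb S^d.$$ Then $$I_F(\mu)-I_F(\sigma)=D_{L^2,f}^2(\mu).$$ In particular, for $\mu=\frac1N\sum_{i=1}^N\delta_{z_i}$ with $Z=\{z_1,\dots,z_N\}\subset\mathbb S^d$, $$\frac1{N^2}\sum_{i,j=1}^NF(z_i\cdot z_j)-\int_{\mathbb S^d}\int_{\mathbb S^d}F(x\cdot y)\,d\sigma(x)\,d\sigma(y)=D_{L^2,f}^2(Z).$$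
   Context: $\mathbb S^d\subset\mathbb R^{d+1}$ is the unit sphere and $\sigma$ is the normalized surface measure ($\sigma(\mathbb S^d)=1$). $\Phi_d$ is the class of functions $F\in C[-1,1]$ that are positive definite on $\mathbb S^d$: for every finite set $\{z_1,\dots,z_N\}\subset\mathbb S^d$ and all $c_i\in\mathbb R$, $\sum_{i,j}F(z_i\cdot z_j)c_ic_j\ge0$. $L^2_{w_\lambda}[-1,1]$ is the space of real measurable $f$ on $[-1,1]$ with $\int_{-1}^1|f(t)|^2(1-t^2)^{\lambda-\frac12}dt<\infty$. The energy integral is $I_F(\mu)=\int_{\mathbb S^d}\int_{\mathbb S^d}F(x\cdot y)\,d\mu(x)\,d\mu(y)$. The $L^2$ discrepancy of $\mu$ with respect to $f$ is $$D_{L^2,f}(\mu)=\left(\int_{\mathbb S^d}\Big|\int_{\mathbb S^d}f(x\cdot y)\,d\mu(y)-\int_{\mathbb S^d}f(x\cdot y)\,d\sigma(y)\Big|^2d\sigma(x)\right)^{1/2}$$ (the inner integrals being defined for $\sigma$-a.e. $x$), and for a finite point set $Z=\{z_1,\dots,z_N\}$, $D_{L^2,f}(Z)=D_{L^2,f}\big(\frac1N\sum_{j=1}^N\delta_{z_j}\big)$. *)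

theory Defs
  imports "HOL-Analysis.Analysis" "HOL-Probability.Probability"
begin

abbreviation unit_sphere :: "'a::euclidean_space set" where
  "unit_sphere \<equiv> sphere 0 1"

abbreviation sphere_borel :: "'a::euclidean_space measure" where
  "sphere_borel \<equiv> restrict_space borel unit_sphere"

text \<open>Normalized surface measure, as the cone measure: the measure of \<open>A\<close> is
  \<open>vol {t *\<^sub>R x | 0 < t < 1, x \<in> A} / vol (ball 0 1)\<close>, the image of the uniform distribution
  on the unit ball under the radial projection \<open>sgn x = x /\<^sub>R norm x\<close>. The origin, a null set,
  is removed so that the projection takes values in the sphere
  (see \<open>emeasure_sphere_sigma\<close> below).\<close>

definition sphere_sigma :: "'a::euclidean_space measure" where
  "sphere_sigma =
     distr (restrict_space (uniform_measure lborel (ball 0 1)) (- {0})) sphere_borel sgn"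

text \<open>A finite signed measure is a real-valued, countably additive set function on the measurable
  sets of \<open>M\<close>; its values on other sets are irrelevant.\<close>

definition finite_signed_measure :: "'a measure \<Rightarrow> ('a set \<Rightarrow> real) \<Rightarrow> bool" where
  "finite_signed_measure M \<nu> \<longleftrightarrow>
     \<nu> {} = 0 \<and>
     (\<forall>A :: nat \<Rightarrow> 'a set. range A \<subseteq> sets M \<longrightarrow> disjoint_family A \<longrightarrow>
        (\<lambda>i. \<nu> (A i)) sums \<nu> (\<Union>i. A i))"

text \<open>The two parts of the Jordan decomposition: \<open>\<nu>\<^sup>+ A = sup {\<nu> B | B \<subseteq> A}\<close> and
  \<open>\<nu>\<^sup>- = (- \<nu>)\<^sup>+\<close>. As \<open>B = {}\<close> is admitted, the truncation of negative values by
  \<open>ennreal\<close> does not change the supremum.\<close>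

definition pos_variation :: "'a measure \<Rightarrow> ('a set \<Rightarrow> real) \<Rightarrow> 'a measure" where
  "pos_variation M \<nu> =
     measure_of (space M) (sets M) (\<lambda>A. SUP B\<in>{B \<in> sets M. B \<subseteq> A}. ennreal (\<nu> B))"

definition neg_variation :: "'a measure \<Rightarrow> ('a set \<Rightarrow> real) \<Rightarrow> 'a measure" where
  "neg_variation M \<nu> = pos_variation M (\<lambda>A. - \<nu> A)"

text \<open>Integration is with respect to the completed measures, since \<open>f\<close> below is only assumed
  Lebesgue measurable; for Borel functions the completion makes no difference.\<close>

definition signed_integrable :: "'a measure \<Rightarrow> ('a set \<Rightarrow> real) \<Rightarrow> ('a \<Rightarrow> real) \<Rightarrow> bool" where
  "signed_integrable M \<nu> g \<longleftrightarrow>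
     integrable (completion (pos_variation M \<nu>)) g \<and> integrable (completion (neg_variation M \<nu>)) g"

definition signed_integral :: "'a measure \<Rightarrow> ('a set \<Rightarrow> real) \<Rightarrow> ('a \<Rightarrow> real) \<Rightarrow> real" where
  "signed_integral M \<nu> g =
     (LINT x|completion (pos_variation M \<nu>). g x) - (LINT x|completion (neg_variation M \<nu>). g x)"

definition posdef_class :: "'a::euclidean_space set \<Rightarrow> (real \<Rightarrow> real) set" where
  "posdef_class S =
     {F. continuous_on {-1..1} F \<and>
         (\<forall>Z c. finite Z \<longrightarrow> Z \<subseteq> S \<longrightarrow> (\<Sum>x\<in>Z. \<Sum>y\<in>Z. F (x \<bullet> y) * c x * c y) \<ge> 0)}"

text \<open>The exponent \<open>l - 1/2\<close> is negative for \<open>l = 0\<close>; the value \<open>0 powr (- 1/2) = 0\<close> at the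
  end points concerns a null set only.\<close>

definition weighted_L2 :: "real \<Rightarrow> (real \<Rightarrow> real) set" where
  "weighted_L2 l =
     {f. f \<in> borel_measurable (lebesgue_on {-1..1}) \<and>
         integrable (lebesgue_on {-1..1}) (\<lambda>t. \<bar>f t\<bar>\<^sup>2 * (1 - t\<^sup>2) powr (l - 1/2))}"

definition energy :: "(real \<Rightarrow> real) \<Rightarrow> ('a::euclidean_space set \<Rightarrow> real) \<Rightarrow> real" where
  "energy F \<mu> =
     signed_integral sphere_borel \<mu> (\<lambda>y. signed_integral sphere_borel \<mu> (\<lambda>x. F (x \<bullet> y)))"

definition discrepancy_at ::
    "(real \<Rightarrow> real) \<Rightarrow> ('a::euclidean_space set \<Rightarrow> real) \<Rightarrow> 'a \<Rightarrow> real" where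
  "discrepancy_at f \<mu> x =
     signed_integral sphere_borel \<mu> (\<lambda>y. f (x \<bullet> y)) - (LINT y|completion sphere_sigma. f (x \<bullet> y))"

definition L2_discrepancy :: "(real \<Rightarrow> real) \<Rightarrow> ('a::euclidean_space set \<Rightarrow> real) \<Rightarrow> real" where
  "L2_discrepancy f \<mu> = sqrt (LINT x|completion sphere_sigma. \<bar>discrepancy_at f \<mu> x\<bar>\<^sup>2)"

text \<open>Point sets are given by enumerations \<open>z 0, \<dots>, z (N - 1)\<close>, repetitions being allowed.\<close>

definition empirical_measure :: "nat \<Rightarrow> (nat \<Rightarrow> 'a) \<Rightarrow> 'a set \<Rightarrow> real" where
  "empirical_measure N z A = (1 / real N) * (\<Sum>j<N. indicator A (z j))"

definition point_discrepancy :: "(real \<Rightarrow> real) \<Rightarrow> nat \<Rightarrow> (nat \<Rightarrow> 'a::euclidean_space) \<Rightarrow> real" where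
  "point_discrepancy f N z = L2_discrepancy f (empirical_measure N z)"

lemma sgn_measurable_sphere:
  "sgn \<in> measurable (restrict_space (uniform_measure lborel (ball 0 1)) (- {0}))
           (sphere_borel :: 'a::euclidean_space measure)"
proof (rule measurable_restrict_space2)
  have s: "sgn = (\<lambda>x::'a. x /\<^sub>R norm x)" by (auto simp: sgn_div_norm)
  have "(sgn :: 'a \<Rightarrow> 'a) \<in> borel_measurable borel" unfolding s by measurable
  then have "(sgn :: 'a \<Rightarrow> 'a) \<in> measurable (uniform_measure lborel (ball 0 1)) borel"
    by (simp cong: measurable_cong_sets)
  then show "(sgn :: 'a \<Rightarrow> 'a)
      \<in> measurable (restrict_space (uniform_measure lborel (ball 0 1)) (- {0})) borel"
    by (rule measurable_restrict_space1)
qed (auto simp: space_restrict_space norm_sgn)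

lemma emeasure_sphere_sigma:
  fixes A :: "'a::euclidean_space set"
  assumes A: "A \<in> sets sphere_borel"
  shows "emeasure sphere_sigma A =
    emeasure lborel {t *\<^sub>R x |t x. 0 < t \<and> t < 1 \<and> x \<in> A} / emeasure lborel (ball (0::'a) 1)"
proof -
  let ?U = "uniform_measure lborel (ball (0::'a) 1)"
  let ?R = "restrict_space ?U (- {0})"
  let ?P = "sgn -` A \<inter> (- {0})"
  have AS: "A \<subseteq> unit_sphere" using sets.sets_into_space[OF A] by (simp add: space_restrict_space)
  have PR: "?P \<in> sets ?R"
    using measurable_sets[OF sgn_measurable_sphere A] by (simp add: space_restrict_space)
  then have P: "?P \<in> sets borel"
    by (subst (asm) sets_restrict_space_iff) auto
  have eq: "ball 0 1 \<inter> ?P = {t *\<^sub>R x |t x. 0 < t \<and> t < 1 \<and> x \<in> A}" (is "_ = ?C")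
  proof (intro equalityI subsetI)
    fix y assume y: "y \<in> ball 0 1 \<inter> ?P"
    then have "y = norm y *\<^sub>R sgn y" "0 < norm y" "norm y < 1" "sgn y \<in> A"
      by (auto simp: sgn_div_norm)
    then show "y \<in> ?C" by blast
  next
    fix y assume "y \<in> ?C"
    then obtain t x where y: "y = t *\<^sub>R x" "0 < t" "t < 1" "x \<in> A" by blast
    then have "norm x = 1" using AS by auto
    then have "sgn y = x" "norm y = t" "y \<noteq> 0" using y by (auto simp: sgn_div_norm)
    then show "y \<in> ball 0 1 \<inter> ?P" using y by auto
  qed
  have "emeasure sphere_sigma A = emeasure ?R ?P"
    unfolding sphere_sigma_def
    by (subst emeasure_distr[OF sgn_measurable_sphere A]) (simp add: space_restrict_space)
  also have "\<dots> = emeasure ?U ?P"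
    by (rule emeasure_restrict_space) auto
  also have "\<dots> = emeasure lborel (ball 0 1 \<inter> ?P) / emeasure lborel (ball (0::'a) 1)"
    using P by (simp add: emeasure_uniform_measure)
  finally show ?thesis unfolding eq .
qed

lemma prob_space_sphere_sigma: "prob_space (sphere_sigma :: 'a::euclidean_space measure)"
proof
  let ?S = "unit_sphere :: 'a set"
  have sp: "space (sphere_sigma :: 'a measure) = ?S"
    by (simp add: sphere_sigma_def space_restrict_space)
  have S: "?S \<in> sets sphere_borel" by (simp add: sets_restrict_space_iff)
  have "{t *\<^sub>R x |t x. 0 < t \<and> t < 1 \<and> x \<in> ?S} = ball 0 1 - {0}" (is "?C = _")
  proof (intro equalityI subsetI)
    fix y :: 'a assume "y \<in> ball 0 1 - {0}"
    then have "y = norm y *\<^sub>R sgn y" "0 < norm y" "norm y < 1" "sgn y \<in> ?S"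
      by (auto simp: sgn_div_norm)
    then show "y \<in> ?C" by blast
  qed (auto simp: dist_norm)
  moreover have "emeasure lborel (ball 0 1 - {0::'a}) = emeasure lborel (ball (0::'a) 1)"
    by (rule emeasure_Diff_null_set) (auto simp: null_sets_def)
  moreover have "emeasure lborel (ball (0::'a) 1) \<noteq> 0" "emeasure lborel (ball (0::'a) 1) \<noteq> \<infinity>"
    using emeasure_lborel_ball_finite[of "0::'a" 1] content_ball_pos[of 1 "0::'a"]
    by (auto simp: measure_def)
  ultimately show "emeasure sphere_sigma (space (sphere_sigma :: 'a measure)) = 1"
    unfolding sp emeasure_sphere_sigma[OF S] by (simp add: ennreal_divide_self top.not_eq_extremum)
qed

end

theory Submission
  imports Defs
begin

text \<open>Write \<open>p \<nu> z = \<integral> f (z \<bullet> y) d\<nu>(y)\<close>. Inserting \<open>F (x \<bullet> y) = \<integral> f (x \<bullet> z) f (z \<bullet> y) d\<sigma>(z)\<close> into the energy and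
  exchanging the integrals gives \<open>I\<^sub>F(\<nu>) = \<integral> (p \<nu>)\<^sup>2 d\<sigma>\<close>. By rotation invariance \<open>p \<sigma>\<close> is a constant \<open>m\<close>,
  and \<open>\<integral> p \<mu> d\<sigma> = m \<mu>(S) = m\<close>, so that
  \<open>D\<^sup>2 = \<integral> (p \<mu> - m)\<^sup>2 d\<sigma> = \<integral> (p \<mu>)\<^sup>2 d\<sigma> - m\<^sup>2 = I\<^sub>F(\<mu>) - I\<^sub>F(\<sigma>)\<close>.
  Fubini applies because the image of \<open>\<sigma>\<close> under \<open>z \<mapsto> x \<bullet> z\<close> is bounded by a multiple of
  \<open>(1 - t\<^sup>2) powr (d/2 - 1) dt\<close>, uniformly in \<open>x\<close>: hence the functions \<open>f (x \<bullet> _)\<close> are bounded in \<open>L\<^sup>2(\<sigma>)\<close>,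
  and a change of \<open>f\<close> on a null set, which turns it into a Borel function, is not seen by
  \<open>f (x \<bullet> _)\<close> for almost every \<open>x\<close>, whatever the finite measure on the sphere.\<close>

section \<open>Finite signed measures\<close>

lemma finite_signed_measure_Un:
  assumes "finite_signed_measure M \<nu>" "A \<in> sets M" "B \<in> sets M" "A \<inter> B = {}"
  shows "\<nu> (A \<union> B) = \<nu> A + \<nu> B"
proof -
  have "range (binaryset A B) \<subseteq> sets M" "disjoint_family (binaryset A B)"
    using assms by (auto simp: range_binaryset_eq disjoint_family_on_def binaryset_def)
  then have "(\<lambda>i. \<nu> (binaryset A B i)) sums \<nu> (\<Union>i. binaryset A B i)"
    using assms(1) unfolding finite_signed_measure_def by blast
  moreover have "(\<lambda>i. \<nu> (binaryset A B i)) sums (\<nu> A + \<nu> B)"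
    using assms(1) by (intro binaryset_sums) (simp add: finite_signed_measure_def)
  ultimately show ?thesis
    by (metis sums_unique2 UN_binaryset_eq)
qed

lemma finite_signed_measure_Diff:
  assumes "finite_signed_measure M \<nu>" "A \<in> sets M" "B \<in> sets M" "B \<subseteq> A"
  shows "\<nu> (A - B) = \<nu> A - \<nu> B"
  using finite_signed_measure_Un[OF assms(1), of "A - B" B] assms by (simp add: Un_absorb2 Diff_disjoint Int_commute)

text \<open>Exhaustion argument: call a set big if \<nu> is unbounded on its measurable subsets. If
  the whole space were big, every big set would shrink to a big subset by removing a piece with
  |\<nu>| > 1. The removed pieces are disjoint, so their \<nu>-values form a convergent series whose
  terms do not tend to 0.\<close>

lemma finite_signed_measure_bounded:
  assumes \<nu>: "finite_signed_measure M \<nu>"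
  shows "\<exists>K. \<forall>A\<in>sets M. \<bar>\<nu> A\<bar> \<le> K"
proof (rule ccontr)
  assume unbounded: "\<nexists>K. \<forall>A\<in>sets M. \<bar>\<nu> A\<bar> \<le> K"
  define big where "big A \<longleftrightarrow> A \<in> sets M \<and> (\<forall>K. \<exists>B. B \<in> sets M \<and> B \<subseteq> A \<and> \<bar>\<nu> B\<bar> > K)" for A
  have big_sets: "A \<in> sets M" if "big A" for A using that by (simp add: big_def)
  have bigD: "\<exists>B. B \<in> sets M \<and> B \<subseteq> A \<and> \<bar>\<nu> B\<bar> > K" if "big A" for A K
    using that by (simp add: big_def)
  have not_bigD: "\<exists>K. \<forall>B. B \<in> sets M \<longrightarrow> B \<subseteq> A \<longrightarrow> \<bar>\<nu> B\<bar> \<le> K" if "\<not> big A" "A \<in> sets M" for A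
    using that unfolding big_def not_less[symmetric] by blast
  have big_space: "big (space M)"
  proof (rule ccontr)
    assume "\<not> big (space M)"
    then obtain K where K: "\<And>B. B \<in> sets M \<Longrightarrow> B \<subseteq> space M \<Longrightarrow> \<bar>\<nu> B\<bar> \<le> K"
      using not_bigD[of "space M"] by auto
    have "\<forall>B\<in>sets M. \<bar>\<nu> B\<bar> \<le> K" by (intro ballI K sets.sets_into_space)
    then show False using unbounded by (elim notE exI)
  qed
  have step: "\<exists>A'. big A' \<and> A' \<subseteq> A \<and> \<bar>\<nu> (A - A')\<bar> > 1" if "big A" for A
  proof -
    have A: "A \<in> sets M" by (rule big_sets[OF that])
    \<comment> \<open>The threshold \<open>1 + \<bar>\<nu> A\<bar>\<close> makes both
      \<open>B\<close> and \<open>A - B\<close> have |\<nu>| > 1, so whichever of them is not kept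
      can serve as the removed piece.\<close>
    obtain B where B: "B \<in> sets M" "B \<subseteq> A" "\<bar>\<nu> B\<bar> > 1 + \<bar>\<nu> A\<bar>"
      using bigD[OF \<open>big A\<close>, of "1 + \<bar>\<nu> A\<bar>"] by auto
    have "\<nu> (A - B) = \<nu> A - \<nu> B"
      by (rule finite_signed_measure_Diff[OF \<nu> A B(1,2)])
    then have *: "\<bar>\<nu> (A - B)\<bar> > 1" "\<bar>\<nu> B\<bar> > 1" using B(3) by linarith+
    \<comment> \<open>If neither part were big, the bounds on the two parts would add up to a bound
      on all subsets of \<open>A\<close>.\<close>
    have "big B \<or> big (A - B)"
    proof (rule ccontr)
      assume "\<not> (big B \<or> big (A - B))"
      then have "\<not> big B" "\<not> big (A - B)" by simp_all
      obtain K1 where K1: "\<bar>\<nu> C\<bar> \<le> K1" if "C \<in> sets M" "C \<subseteq> B" for C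
        using not_bigD[OF \<open>\<not> big B\<close> B(1)] by auto
      obtain K2 where K2: "\<bar>\<nu> C\<bar> \<le> K2" if "C \<in> sets M" "C \<subseteq> A - B" for C
        using not_bigD[OF \<open>\<not> big (A - B)\<close> sets.Diff[OF A B(1)]] by auto
      obtain C where C: "C \<in> sets M" "C \<subseteq> A" "\<bar>\<nu> C\<bar> > K1 + K2"
        using bigD[OF \<open>big A\<close>, of "K1 + K2"] by auto
      have "\<nu> C = \<nu> (C \<inter> B) + \<nu> (C - B)"
        using finite_signed_measure_Un[OF \<nu>, of "C \<inter> B" "C - B"] B(1) C(1)
        by (simp add: Int_Diff_Un Int_Diff_disjoint)
      moreover have "\<bar>\<nu> (C \<inter> B)\<bar> \<le> K1" using B(1) C(1) by (intro K1) auto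
      moreover have "\<bar>\<nu> (C - B)\<bar> \<le> K2" using B(1) C(1,2) by (intro K2) auto
      ultimately show False using C(3) by linarith
    qed
    moreover have "A - (A - B) = B" using B(2) by blast
    ultimately show ?thesis
    proof (elim disjE)
      assume "big B"
      then show ?thesis using B(2) *(1) by (intro exI[of _ B]) simp
    next
      assume "big (A - B)" "A - (A - B) = B"
      then show ?thesis using *(2) by (intro exI[of _ "A - B"]) simp
    qed
  qed
  have "\<exists>S. \<forall>n. big (S n) \<and> (S (Suc n) \<subseteq> S n \<and> \<bar>\<nu> (S n - S (Suc n))\<bar> > 1)"
    by (rule dependent_nat_choice[of "\<lambda>_. big"]) (use big_space step in auto)
  then obtain S where *: "\<forall>n. big (S n) \<and> (S (Suc n) \<subseteq> S n \<and> \<bar>\<nu> (S n - S (Suc n))\<bar> > 1)"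
    by (rule exE)
  have S: "big (S n)" "S (Suc n) \<subseteq> S n" "\<bar>\<nu> (S n - S (Suc n))\<bar> > 1" for n
    using * by simp_all
  have "decseq S" using S(2) by (rule decseq_SucI)
  then have sub: "S n \<subseteq> S (Suc m)" if "m < n" for m n
    using that decseqD[of S "Suc m" n] by simp
  have disj: "(S m - S (Suc m)) \<inter> (S n - S (Suc n)) = {}" if "m < n" for m n
    using sub[OF that] by blast
  have "disjoint_family (\<lambda>n. S n - S (Suc n))"
    unfolding disjoint_family_on_def
  proof (intro ballI impI)
    fix m n :: nat assume "m \<noteq> n"
    then show "(S m - S (Suc m)) \<inter> (S n - S (Suc n)) = {}"
      using disj[of m n] disj[of n m] by (cases "m < n") (simp_all add: Int_commute)
  qed
  moreover have "range (\<lambda>n. S n - S (Suc n)) \<subseteq> sets M"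
    using big_sets[OF S(1)] by (intro image_subsetI sets.Diff)
  ultimately have "(\<lambda>n. \<nu> (S n - S (Suc n))) sums \<nu> (\<Union>n. S n - S (Suc n))"
    using \<nu> unfolding finite_signed_measure_def by blast
  then have "(\<lambda>n. \<nu> (S n - S (Suc n))) \<longlonglongrightarrow> 0"
    by (intro summable_LIMSEQ_zero sums_summable)
  then have "\<forall>\<^sub>F n in sequentially. \<bar>\<nu> (S n - S (Suc n))\<bar> < 1"
    by (intro order_tendstoD(2)[OF tendsto_rabs_zero]) simp_all
  then obtain n where "\<bar>\<nu> (S n - S (Suc n))\<bar> < 1"
    by (auto simp: eventually_sequentially)
  then show False using S(3)[of n] by simp
qed

section \<open>Jordan decomposition\<close>

lemma finite_signed_measure_uminus:
  "finite_signed_measure M \<nu> \<Longrightarrow> finite_signed_measure M (\<lambda>A. - \<nu> A)"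
  unfolding finite_signed_measure_def by (simp add: sums_minus)

lemma space_pos_variation [simp]: "space (pos_variation M \<nu>) = space M"
  and sets_pos_variation [simp, measurable_cong]: "sets (pos_variation M \<nu>) = sets M"
  and space_neg_variation [simp]: "space (neg_variation M \<nu>) = space M"
  and sets_neg_variation [simp, measurable_cong]: "sets (neg_variation M \<nu>) = sets M"
  by (simp_all add: neg_variation_def pos_variation_def sets.space_closed)

text \<open>Competitors \<open>C\<close> for \<open>A\<close> and \<open>D\<close> for
  \<open>B\<close> combine to the competitor \<open>C \<union> D\<close>, over which \<nu> adds.
  This is the harder direction of additivity for finitely many sets in disguise: it bounds partial
  sums in the countable case.\<close>

lemma SUP_variation_superadditive:
  fixes \<nu> :: "'a set \<Rightarrow> real"
  assumes \<nu>: "finite_signed_measure M \<nu>" and AB: "A \<inter> B = {}"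
  shows "(SUP C\<in>{C \<in> sets M. C \<subseteq> A}. ennreal (\<nu> C)) + (SUP C\<in>{C \<in> sets M. C \<subseteq> B}. ennreal (\<nu> C))
    \<le> (SUP C\<in>{C \<in> sets M. C \<subseteq> A \<union> B}. ennreal (\<nu> C))" (is "?P A + ?P B \<le> _")
proof -
  have le: "ennreal (\<nu> C) + ennreal (\<nu> D) \<le> ?P (A \<union> B)"
    if C: "C \<in> sets M" "C \<subseteq> A" and D: "D \<in> sets M" "D \<subseteq> B" for C D
  proof -
    have "\<nu> (C \<union> D) = \<nu> C + \<nu> D"
      using C D AB by (intro finite_signed_measure_Un[OF \<nu>]) auto
    moreover have "ennreal (\<nu> C) \<le> ?P (A \<union> B)" "ennreal (\<nu> D) \<le> ?P (A \<union> B)"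
        "ennreal (\<nu> (C \<union> D)) \<le> ?P (A \<union> B)"
      using C D by (auto intro!: SUP_upper)
    ultimately show ?thesis
      \<comment> \<open>\<open>ennreal\<close> truncates negative values to 0, so it is additive
        only when both values are nonnegative; otherwise one summand vanishes and the bound on the
        other suffices.\<close>
      by (cases "\<nu> C \<ge> 0"; cases "\<nu> D \<ge> 0") (simp_all add: ennreal_plus[symmetric] ennreal_neg del: ennreal_plus)
  qed
  have ne: "{C \<in> sets M. C \<subseteq> A} \<noteq> {}" "{C \<in> sets M. C \<subseteq> B} \<noteq> {}" by auto
  have "?P A + ?P B = (SUP C\<in>{C \<in> sets M. C \<subseteq> A}. ennreal (\<nu> C) + ?P B)"
    by (rule ennreal_SUP_add_left[OF ne(1), symmetric])
  also have "\<dots> = (SUP C\<in>{C \<in> sets M. C \<subseteq> A}. SUP D\<in>{D \<in> sets M. D \<subseteq> B}. ennreal (\<nu> D) + ennreal (\<nu> C))"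
    by (subst ennreal_SUP_add_left[OF ne(2)]) (simp add: add.commute)
  also have "\<dots> \<le> ?P (A \<union> B)"
    using le by (intro SUP_least) (auto simp: add.commute)
  finally show ?thesis .
qed

text \<open>\<open>measure_of\<close> returns the given set function only if that function is
  countably additive. Superadditivity bounds the series from above. Conversely, a competitor
  \<open>B\<close> for the union is cut into the pieces \<open>B \<inter> A i\<close>, and \<nu> of
  \<open>B\<close> is the limit of the partial sums over these pieces.\<close>

lemma emeasure_pos_variation:
  fixes \<nu> :: "'a set \<Rightarrow> real"
  assumes \<nu>: "finite_signed_measure M \<nu>" and A: "A \<in> sets M"
  shows "emeasure (pos_variation M \<nu>) A = (SUP B\<in>{B \<in> sets M. B \<subseteq> A}. ennreal (\<nu> B))"
proof -
  define p where "p A = (SUP B\<in>{B \<in> sets M. B \<subseteq> A}. ennreal (\<nu> B))" for A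
  have upper: "ennreal (\<nu> B) \<le> p A" if "B \<in> sets M" "B \<subseteq> A" for A B
    unfolding p_def using that by (intro SUP_upper) simp
  have p_empty: "p {} = 0"
  proof -
    have "{B \<in> sets M. B \<subseteq> {}} = {{}}" by auto
    moreover have "\<nu> {} = 0" using \<nu> by (simp add: finite_signed_measure_def)
    ultimately show ?thesis by (simp add: p_def)
  qed
  have add: "p A + p B \<le> p (A \<union> B)" if "A \<inter> B = {}" for A B
    unfolding p_def using that by (rule SUP_variation_superadditive[OF \<nu>])
  have mono: "p A \<le> p B" if "A \<subseteq> B" for A B
    unfolding p_def using that by (intro SUP_subset_mono) auto
  have "countably_additive (sets M) p"
  proof (rule countably_additiveI)
    fix A :: "nat \<Rightarrow> 'a set"
    assume A: "range A \<subseteq> sets M" and disj: "disjoint_family A"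
    show "(\<Sum>i. p (A i)) = p (\<Union>i. A i)"
    proof (rule antisym)
      have "(\<Sum>i<n. p (A i)) \<le> p (\<Union>i<n. A i)" for n
      proof (induction n)
        case (Suc n)
        have "A i \<inter> A n = {}" if "i < n" for i
          using disj that by (intro disjoint_family_onD) auto
        then have "(\<Union>i<n. A i) \<inter> A n = {}" by blast
        then have "p (\<Union>i<n. A i) + p (A n) \<le> p (\<Union>i<Suc n. A i)"
          using add[of "\<Union>i<n. A i" "A n"] by (simp add: lessThan_Suc Un_commute)
        with Suc show ?case by (auto intro: order_trans[OF add_right_mono])
      qed (simp add: p_empty)
      also have "p (\<Union>i<n. A i) \<le> p (\<Union>i. A i)" for n by (rule mono) auto
      finally show "(\<Sum>i. p (A i)) \<le> p (\<Union>i. A i)"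
        by (intro suminf_le_const) auto
      show "p (\<Union>i. A i) \<le> (\<Sum>i. p (A i))"
        unfolding p_def[of "\<Union>i. A i"]
      proof (intro SUP_least, clarify)
        fix B assume B: "B \<in> sets M" "B \<subseteq> (\<Union>i. A i)"
        have "range (\<lambda>i. B \<inter> A i) \<subseteq> sets M" using A B(1) by auto
        moreover have "disjoint_family (\<lambda>i. B \<inter> A i)"
          using disj by (auto simp: disjoint_family_on_def)
        ultimately have "(\<lambda>i. \<nu> (B \<inter> A i)) sums \<nu> (\<Union>i. B \<inter> A i)"
          using \<nu> unfolding finite_signed_measure_def by blast
        moreover have "(\<Union>i. B \<inter> A i) = B" using B(2) by auto
        ultimately have "(\<lambda>n. ennreal (\<Sum>i<n. \<nu> (B \<inter> A i))) \<longlonglongrightarrow> ennreal (\<nu> B)"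
          by (auto simp: sums_def intro: tendsto_ennrealI)
        moreover have "ennreal (\<Sum>i<n. \<nu> (B \<inter> A i)) \<le> (\<Sum>i. p (A i))" for n
        proof -
          \<comment> \<open>Negative terms are replaced by 0, which \<open>ennreal\<close> does to
            each term anyway; only then may it be exchanged with the sum.\<close>
          have "ennreal (\<Sum>i<n. \<nu> (B \<inter> A i)) \<le> ennreal (\<Sum>i<n. max 0 (\<nu> (B \<inter> A i)))"
            by (intro ennreal_leI sum_mono) auto
          also have "\<dots> = (\<Sum>i<n. ennreal (\<nu> (B \<inter> A i)))"
            by (subst sum_ennreal[symmetric]) auto
          also have "\<dots> \<le> (\<Sum>i<n. p (A i))"
            using A B(1) by (intro sum_mono upper) auto
          also have "\<dots> \<le> (\<Sum>i. p (A i))" by (rule sum_le_suminf) auto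
          finally show ?thesis .
        qed
        ultimately show "ennreal (\<nu> B) \<le> (\<Sum>i. p (A i))"
          by (intro LIMSEQ_le_const2) auto
      qed
    qed
  qed
  moreover have "positive (sets M) p" by (simp add: positive_def p_empty)
  ultimately have "emeasure (pos_variation M \<nu>) A = p A"
    using A unfolding pos_variation_def p_def[abs_def]
    by (intro emeasure_measure_of_sigma sets.sigma_algebra_axioms)
  then show ?thesis by (simp add: p_def)
qed

lemma finite_measure_pos_variation:
  assumes \<nu>: "finite_signed_measure M \<nu>"
  shows "finite_measure (pos_variation M \<nu>)"
proof
  obtain K where "\<forall>A\<in>sets M. \<bar>\<nu> A\<bar> \<le> K"
    using finite_signed_measure_bounded[OF \<nu>] by blast
  then have "ennreal (\<nu> B) \<le> ennreal K" if "B \<in> sets M" for B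
    using that by (intro ennreal_leI) (auto dest: abs_le_D1)
  then have "emeasure (pos_variation M \<nu>) (space M) \<le> ennreal K"
    unfolding emeasure_pos_variation[OF \<nu> sets.top] by (intro SUP_least) simp
  then show "emeasure (pos_variation M \<nu>) (space (pos_variation M \<nu>)) \<noteq> \<infinity>"
    using neq_top_trans[OF ennreal_neq_top] by simp
qed

lemma finite_measure_neg_variation:
  "finite_signed_measure M \<nu> \<Longrightarrow> finite_measure (neg_variation M \<nu>)"
  unfolding neg_variation_def
  by (intro finite_measure_pos_variation finite_signed_measure_uminus)

text \<open>For \<open>B \<subseteq> A\<close>, \<open>\<nu> B = \<nu> A - \<nu> (A - B)\<close>,
  and \<open>- \<nu> (A - B)\<close> is at most the negative variation of \<open>A\<close>. Taking
  the supremum over \<open>B\<close> gives the claim.\<close>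

lemma measure_pos_variation_le:
  assumes \<nu>: "finite_signed_measure M \<nu>" and A: "A \<in> sets M"
  shows "measure (pos_variation M \<nu>) A \<le> \<nu> A + measure (neg_variation M \<nu>) A"
proof -
  interpret P: finite_measure "pos_variation M \<nu>" by (rule finite_measure_pos_variation[OF \<nu>])
  interpret N: finite_measure "neg_variation M \<nu>" by (rule finite_measure_neg_variation[OF \<nu>])
  have le: "- \<nu> B \<le> measure (neg_variation M \<nu>) A" if "B \<in> sets M" "B \<subseteq> A" for B
  proof -
    have "ennreal (- \<nu> B) \<le> emeasure (neg_variation M \<nu>) A"
      unfolding neg_variation_def
      unfolding emeasure_pos_variation[OF finite_signed_measure_uminus[OF \<nu>] A]
      using that by (intro SUP_upper) simp
    then show ?thesis
      unfolding N.emeasure_eq_measure by simp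
  qed
  have "ennreal (\<nu> B) \<le> ennreal (\<nu> A + measure (neg_variation M \<nu>) A)" if "B \<in> sets M" "B \<subseteq> A" for B
  proof (rule ennreal_leI)
    have "- \<nu> (A - B) \<le> measure (neg_variation M \<nu>) A"
      using that A by (intro le) auto
    then show "\<nu> B \<le> \<nu> A + measure (neg_variation M \<nu>) A"
      using finite_signed_measure_Diff[OF \<nu> A that] by simp
  qed
  then have "emeasure (pos_variation M \<nu>) A \<le> ennreal (\<nu> A + measure (neg_variation M \<nu>) A)"
    unfolding emeasure_pos_variation[OF \<nu> A] by (intro SUP_least) simp
  \<comment> \<open>The case \<open>B = A\<close> of \<open>le\<close>: the bound is nonnegative, so
    it survives the passage through \<open>ennreal\<close>.\<close>
  moreover have "0 \<le> \<nu> A + measure (neg_variation M \<nu>) A" using le[OF A] by simp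
  ultimately show ?thesis by (simp add: P.emeasure_eq_measure)
qed

text \<open>The preceding inequality for \<nu> and for its negative, where the two variations trade
  places, gives both directions.\<close>

lemma jordan_decomposition:
  assumes \<nu>: "finite_signed_measure M \<nu>" and A: "A \<in> sets M"
  shows "\<nu> A = measure (pos_variation M \<nu>) A - measure (neg_variation M \<nu>) A"
  using measure_pos_variation_le[OF assms]
    measure_pos_variation_le[OF finite_signed_measure_uminus[OF \<nu>] A]
  by (simp add: neg_variation_def)

section \<open>Nonnegative measures viewed as signed measures\<close>

lemma finite_signed_measure_measure:
  assumes "finite_measure N" "sets N = sets M" "\<And>A. A \<in> sets M \<Longrightarrow> \<nu> A = measure N A"
  shows "finite_signed_measure M \<nu>"
proof -
  interpret finite_measure N by fact
  show ?thesis
    unfolding finite_signed_measure_def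
  proof (intro conjI allI impI)
    fix A :: "nat \<Rightarrow> _" assume A: "range A \<subseteq> sets M" "disjoint_family A"
    then have "\<nu> (A i) = measure N (A i)" "\<nu> (\<Union>i. A i) = measure N (\<Union>i. A i)" for i
      by (auto intro!: assms(3))
    then show "(\<lambda>i. \<nu> (A i)) sums \<nu> (\<Union>i. A i)"
      using A assms(2) by (simp add: finite_measure_UNION)
  qed (simp add: assms)
qed

text \<open>By monotonicity the supremum defining the positive variation is attained at the set
  itself.\<close>

lemma pos_variation_measure:
  assumes N: "finite_measure N" and sets: "sets N = sets M"
    and eq: "\<And>A. A \<in> sets M \<Longrightarrow> \<nu> A = measure N A"
  shows "pos_variation M \<nu> = N"
proof (rule measure_eqI)
  interpret finite_measure N by fact
  fix A assume "A \<in> sets (pos_variation M \<nu>)"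
  then have A: "A \<in> sets M" by simp
  have "(SUP B\<in>{B \<in> sets M. B \<subseteq> A}. ennreal (\<nu> B)) = emeasure N A"
    using A sets by (intro antisym SUP_least SUP_upper2[of A])
      (auto simp: eq emeasure_eq_measure finite_measure_mono)
  then show "emeasure (pos_variation M \<nu>) A = emeasure N A"
    using emeasure_pos_variation[OF finite_signed_measure_measure[OF assms] A] by simp
qed (simp add: sets)

lemma neg_variation_measure:
  assumes N: "finite_measure N" and sets: "sets N = sets M"
    and eq: "\<And>A. A \<in> sets M \<Longrightarrow> \<nu> A = measure N A"
  shows "neg_variation M \<nu> = null_measure M"
proof (rule measure_eqI)
  fix A assume "A \<in> sets (neg_variation M \<nu>)"
  then have A: "A \<in> sets M" by simp
  have "emeasure (neg_variation M \<nu>) A = (SUP B\<in>{B \<in> sets M. B \<subseteq> A}. ennreal (- \<nu> B))"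
    unfolding neg_variation_def
    using A by (intro emeasure_pos_variation finite_signed_measure_uminus finite_signed_measure_measure[OF assms])
  also have "\<dots> = 0"
    by (auto simp: eq ennreal_neg intro!: SUP_eq_const)
  finally show "emeasure (neg_variation M \<nu>) A = emeasure (null_measure M) A" by simp
qed simp

text \<open>Allows the surface measure and the empirical measures, which enter the energy as set
  functions, to be handled by ordinary integrals.\<close>

lemma signed_integral_measure:
  assumes "finite_measure N" "sets N = sets M" "\<And>A. A \<in> sets M \<Longrightarrow> \<nu> A = measure N A"
    and g: "g \<in> borel_measurable M"
  shows "signed_integral M \<nu> g = (LINT x|N. g x)"
proof -
  have "(LINT x|completion (null_measure M). g x) = 0"
  proof (rule integral_eq_zero_AE)
    \<comment> \<open>The whole space is a null set here, so every function vanishes almost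
      everywhere.\<close>
    have "AE x in null_measure M. g x = 0" by (rule AE_I'[of "space M"]) (auto simp: null_sets_def)
    then show "AE x in completion (null_measure M). g x = 0" by (rule AE_completion)
  qed
  moreover have "(LINT x|completion N. g x) = (LINT x|N. g x)"
    using g assms(2) by (intro integral_completion) (simp cong: measurable_cong_sets)
  ultimately show ?thesis
    unfolding signed_integral_def
    by (simp add: pos_variation_measure[OF assms(1-3)] neg_variation_measure[OF assms(1-3)])
qed

section \<open>Rotation invariance and zonal integrals\<close>

lemma nn_integral_lborel_affine_unit:
  fixes f :: "'a::euclidean_space \<Rightarrow> ennreal"
  assumes [measurable]: "f \<in> borel_measurable borel" and c: "\<bar>c\<bar> = 1"
  shows "(\<integral>\<^sup>+x. f (t + c *\<^sub>R x) \<partial>lborel) = (\<integral>\<^sup>+x. f x \<partial>lborel)"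
proof -
  have "lborel = distr lborel borel (\<lambda>x::'a. t + c *\<^sub>R x)"
    using lborel_affine[of c t] c by (simp add: density_1)
  then have "(\<integral>\<^sup>+x. f x \<partial>lborel) = (\<integral>\<^sup>+x. f x \<partial>distr lborel borel (\<lambda>x::'a. t + c *\<^sub>R x))"
    by simp
  also have "\<dots> = (\<integral>\<^sup>+x. f (t + c *\<^sub>R x) \<partial>lborel)"
    by (subst nn_integral_distr) auto
  finally show ?thesis by simp
qed

lemma borel_measurable_orthogonal_transformation:
  fixes T :: "'a::euclidean_space \<Rightarrow> 'a"
  assumes "orthogonal_transformation T"
  shows "T \<in> borel_measurable borel"
  using assms orthogonal_transformation_linear
  by (intro borel_measurable_continuous_onI linear_continuous_on linear_conv_bounded_linear[THEN iffD1]) auto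

text \<open>Translating the variables in \<open>\<integral>\<integral> u (T x) v (y + T x)\<close> shows that \<open>lborel\<close> and its image under
  \<open>T\<close> are proportional; the unit ball, invariant under \<open>T\<close>, gives the factor 1.\<close>

lemma nn_integral_lborel_orthogonal_transformation:
  fixes T :: "'a::euclidean_space \<Rightarrow> 'a" and u :: "'a \<Rightarrow> ennreal"
  assumes T: "orthogonal_transformation T" and u[measurable]: "u \<in> borel_measurable borel"
  shows "(\<integral>\<^sup>+x. u (T x) \<partial>lborel) = (\<integral>\<^sup>+x. u x \<partial>lborel)"
proof -
  note [measurable] = borel_measurable_orthogonal_transformation[OF T]
  define v :: "'a \<Rightarrow> ennreal" where "v = indicator (ball 0 1)"
  have [measurable]: "v \<in> borel_measurable borel"
    unfolding v_def by (intro borel_measurable_indicator borel_open open_ball)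
  obtain S where S: "T (S y) = y" for y
    using orthogonal_transformation_surj[OF T] by (metis surjD)
  have T_add: "T (x + y) = T x + T y" for x y
    using orthogonal_transformation_linear[OF T] by (rule linear_add)
  have T_scale: "T (c *\<^sub>R x) = c *\<^sub>R T x" for c x
    using T by (rule orthogonal_transformation_scaleR)
  \<comment> \<open>\<open>S y\<close> is a preimage of \<open>y\<close> under \<open>T\<close>, so
    translating \<open>x\<close> by it adds \<open>y\<close> to \<open>T x\<close>.\<close>
  have shift: "(\<integral>\<^sup>+x. u (T x) * v (y + T x) \<partial>lborel) = (\<integral>\<^sup>+x. u (- y + T x) * v (T x) \<partial>lborel)" for y
  proof -
    have "(\<integral>\<^sup>+x. u (- y + T x) * v (T x) \<partial>lborel)
      = (\<integral>\<^sup>+x. u (- y + T (S y + 1 *\<^sub>R x)) * v (T (S y + 1 *\<^sub>R x)) \<partial>lborel)"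
      by (rule nn_integral_lborel_affine_unit[symmetric]) auto
    also have "\<dots> = (\<integral>\<^sup>+x. u (T x) * v (y + T x) \<partial>lborel)"
      by (simp add: T_add S)
    finally show ?thesis by simp
  qed
  have "(\<integral>\<^sup>+x. u (T x) \<partial>lborel) * (\<integral>\<^sup>+y. v y \<partial>lborel)
      = (\<integral>\<^sup>+x. u (T x) * (\<integral>\<^sup>+y. v y \<partial>lborel) \<partial>lborel)"
    by (rule nn_integral_multc[symmetric]) simp
  also have "\<dots> = (\<integral>\<^sup>+x. u (T x) * (\<integral>\<^sup>+y. v (T x + 1 *\<^sub>R y) \<partial>lborel) \<partial>lborel)"
    by (subst nn_integral_lborel_affine_unit) auto
  also have "\<dots> = (\<integral>\<^sup>+x. (\<integral>\<^sup>+y. u (T x) * v (y + T x) \<partial>lborel) \<partial>lborel)"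
    by (simp add: nn_integral_cmult add.commute)
  also have "\<dots> = (\<integral>\<^sup>+y. (\<integral>\<^sup>+x. u (T x) * v (y + T x) \<partial>lborel) \<partial>lborel)"
    by (rule lborel_pair.Fubini'[symmetric]) measurable
  also have "\<dots> = (\<integral>\<^sup>+y. (\<integral>\<^sup>+x. u (- y + T x) * v (T x) \<partial>lborel) \<partial>lborel)"
    by (simp add: shift)
  also have "\<dots> = (\<integral>\<^sup>+x. (\<integral>\<^sup>+y. u (- y + T x) * v (T x) \<partial>lborel) \<partial>lborel)"
    by (rule lborel_pair.Fubini') measurable
  also have "\<dots> = (\<integral>\<^sup>+x. (\<integral>\<^sup>+y. u (T x + (-1) *\<^sub>R y) \<partial>lborel) * v (T x) \<partial>lborel)"
    by (simp add: nn_integral_multc)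
  also have "\<dots> = (\<integral>\<^sup>+x. (\<integral>\<^sup>+y. u y \<partial>lborel) * v (T x) \<partial>lborel)"
    by (subst nn_integral_lborel_affine_unit) auto
  also have "\<dots> = (\<integral>\<^sup>+y. u y \<partial>lborel) * (\<integral>\<^sup>+x. v (T x) \<partial>lborel)"
    by (rule nn_integral_cmult) simp
  also have "(\<integral>\<^sup>+x. v (T x) \<partial>lborel) = (\<integral>\<^sup>+x. v x \<partial>lborel)"
    using orthogonal_transformation_norm[OF T] by (simp add: v_def indicator_def)
  finally have eq: "(\<integral>\<^sup>+x. u (T x) \<partial>lborel) * (\<integral>\<^sup>+y. v y \<partial>lborel)
      = (\<integral>\<^sup>+y. u y \<partial>lborel) * (\<integral>\<^sup>+x. v x \<partial>lborel)" .
  have "(\<integral>\<^sup>+y. v y \<partial>lborel) = emeasure lborel (ball (0::'a) 1)"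
    unfolding v_def by (rule nn_integral_indicator) simp
  then have "(\<integral>\<^sup>+y. v y \<partial>lborel) \<noteq> 0" "(\<integral>\<^sup>+y. v y \<partial>lborel) \<noteq> top"
    using emeasure_lborel_ball_finite[of "0::'a" 1] content_ball_pos[of 1 "0::'a"]
    by (auto simp: measure_def)
  then show ?thesis
    using eq mult_divide_eq_ennreal by metis
qed

text \<open>The reflection in the hyperplane orthogonal to \<open>x - e\<close> exchanges vectors of
  equal norm. When \<open>x = e\<close> this hyperplane is undefined and the identity is
  taken.\<close>

lemma householder_reflection:
  fixes x e :: "'a::euclidean_space"
  assumes "norm x = norm e"
  obtains T where "orthogonal_transformation T" "T x = e"
proof (cases "x = e")
  case True
  show ?thesis by (rule that[of "\<lambda>v. v"]) (simp_all add: True)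
next
  case False
  define u where "u = x - e"
  define T where "T v = v - (2 * (v \<bullet> u) / (u \<bullet> u)) *\<^sub>R u" for v
  have uu: "u \<bullet> u \<noteq> 0" using False by (simp add: u_def)
  have "linear T"
  proof (rule linearI)
    fix v w c
    show "T (v + w) = T v + T w"
      by (simp add: T_def inner_add_left distrib_left add_divide_distrib scaleR_add_left)
    show "T (c *\<^sub>R v) = c *\<^sub>R T v"
      by (simp add: T_def scaleR_diff_right)
  qed
  moreover have "T v \<bullet> T w = v \<bullet> w" for v w
  proof -
    define a b where "a = 2 * (v \<bullet> u) / (u \<bullet> u)" and "b = 2 * (w \<bullet> u) / (u \<bullet> u)"
    have ab: "a * (u \<bullet> u) = 2 * (v \<bullet> u)" "b * (u \<bullet> u) = 2 * (w \<bullet> u)"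
      using uu by (simp_all add: a_def b_def)
    have "T v \<bullet> T w = v \<bullet> w - b * (v \<bullet> u) - a * (w \<bullet> u) + b * (a * (u \<bullet> u))"
      by (simp add: T_def a_def[symmetric] b_def[symmetric] inner_diff_left inner_diff_right
          inner_commute[of u w] right_diff_distrib mult.assoc)
    also have "\<dots> = v \<bullet> w + b * (v \<bullet> u) - a * (w \<bullet> u)"
      unfolding ab by simp
    also have "b * (v \<bullet> u) = a * (w \<bullet> u)" by (simp add: a_def b_def)
    finally show ?thesis by simp
  qed
  ultimately have "orthogonal_transformation T"
    by (simp add: orthogonal_transformation_def)
  moreover have "T x = e"
  proof -
    have "x \<bullet> x = e \<bullet> e" using assms by (simp add: norm_eq)
    \<comment> \<open>Equality of the norms makes the reflection coefficient of \<open>x\<close>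
      equal to 1, so that \<open>T x = x - u = e\<close>.\<close>
    then have "2 * (x \<bullet> u) = u \<bullet> u"
      by (simp add: u_def inner_diff_left inner_diff_right inner_commute)
    then show ?thesis using uu by (simp add: T_def u_def)
  qed
  ultimately show ?thesis by (rule that)
qed

section \<open>Integration over the sphere: invariance and bounds for zonal functions\<close>

lemma nn_integral_sphere_sigma:
  fixes h :: "'a::euclidean_space \<Rightarrow> ennreal"
  assumes [measurable]: "h \<in> borel_measurable borel"
  shows "(\<integral>\<^sup>+z. h z \<partial>sphere_sigma) =
    (\<integral>\<^sup>+z. h (sgn z) * indicator (ball 0 1) z \<partial>lborel) / emeasure lborel (ball (0::'a) 1)"
proof -
  let ?U = "uniform_measure lborel (ball (0::'a) 1)"
  have s: "sgn = (\<lambda>x::'a. x /\<^sub>R norm x)" by (auto simp: sgn_div_norm)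
  have [measurable]: "(sgn :: 'a \<Rightarrow> 'a) \<in> borel_measurable borel" unfolding s by measurable
  have [measurable]: "ball (0::'a) 1 \<in> sets borel" by (intro borel_open open_ball)
  have "h \<in> borel_measurable sphere_borel"
    by (rule measurable_restrict_space1) simp
  then have "(\<integral>\<^sup>+z. h z \<partial>sphere_sigma) = (\<integral>\<^sup>+z. h (sgn z) \<partial>restrict_space ?U (- {0}))"
    unfolding sphere_sigma_def by (subst nn_integral_distr[OF sgn_measurable_sphere]) simp_all
  also have "\<dots> = (\<integral>\<^sup>+z. h (sgn z) * indicator (- {0}) z \<partial>?U)"
    by (rule nn_integral_restrict_space) simp
  also have "\<dots> = (\<integral>\<^sup>+z. h (sgn z) * indicator (- {0}) z * indicator (ball 0 1) z \<partial>lborel)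
      / emeasure lborel (ball (0::'a) 1)"
    by (rule nn_integral_uniform_measure) measurable
  also have "(\<integral>\<^sup>+z. h (sgn z) * indicator (- {0}) z * indicator (ball 0 1) z \<partial>lborel)
      = (\<integral>\<^sup>+z. h (sgn z) * indicator (ball 0 1) z \<partial>lborel)"
    using AE_lborel_singleton[of "0::'a"] by (intro nn_integral_cong_AE) (auto elim!: eventually_mono)
  finally show ?thesis .
qed

text \<open>An orthogonal \<open>T\<close> with \<open>T x = e\<close> preserves the ball and
  Lebesgue measure, and it commutes with \<open>sgn\<close>; hence \<open>e \<bullet> sgn (T z) = T
  x \<bullet> T (sgn z) = x \<bullet> sgn z\<close>.\<close>

lemma nn_integral_sphere_sigma_inner:
  fixes x e :: "'a::euclidean_space" and h :: "real \<Rightarrow> ennreal"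
  assumes h[measurable]: "h \<in> borel_measurable borel" and "norm x = norm e"
  shows "(\<integral>\<^sup>+z. h (x \<bullet> z) \<partial>sphere_sigma) = (\<integral>\<^sup>+z. h (e \<bullet> z) \<partial>sphere_sigma)"
proof -
  obtain T where T: "orthogonal_transformation T" and Tx: "T x = e"
    using householder_reflection[OF assms(2)] .
  have s: "sgn = (\<lambda>x::'a. x /\<^sub>R norm x)" by (auto simp: sgn_div_norm)
  have [measurable]: "(sgn :: 'a \<Rightarrow> 'a) \<in> borel_measurable borel" unfolding s by measurable
  have [measurable]: "ball (0::'a) 1 \<in> sets borel" by (intro borel_open open_ball)
  have "(\<integral>\<^sup>+z. h (e \<bullet> sgn z) * indicator (ball 0 1) z \<partial>lborel)
    = (\<integral>\<^sup>+z. h (e \<bullet> sgn (T z)) * indicator (ball 0 1) (T z) \<partial>lborel)"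
    by (rule nn_integral_lborel_orthogonal_transformation[OF T, symmetric]) measurable
  also have "\<dots> = (\<integral>\<^sup>+z. h (x \<bullet> sgn z) * indicator (ball 0 1) z \<partial>lborel)"
  proof (rule nn_integral_cong)
    fix z
    have "e \<bullet> sgn (T z) = x \<bullet> sgn z"
      using T by (simp add: Tx[symmetric] sgn_div_norm orthogonal_transformation_norm[OF T] orthogonal_transformation_def)
    then show "h (e \<bullet> sgn (T z)) * indicator (ball 0 1) (T z) = h (x \<bullet> sgn z) * indicator (ball 0 1) z"
      by (simp add: indicator_def orthogonal_transformation_norm[OF T])
  qed
  finally show ?thesis
    by (subst (1 2) nn_integral_sphere_sigma) auto
qed

text \<open>The substitution \<open>t = s / sqrt (s\<^sup>2 + r\<^sup>2)\<close> on the line at distance \<open>r\<close> from the axis. The exact density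
  \<open>r (1 - t\<^sup>2) powr (-3/2)\<close> is at most \<open>1 / (1 - t\<^sup>2)\<close> on the range of integration; the dependence
  on \<open>r\<close> is lost, but an upper bound with the right power of \<open>1 - t\<^sup>2\<close> is all that is needed.\<close>

lemma nn_integral_projection_line_le:
  fixes h :: "real \<Rightarrow> ennreal" and r :: real
  assumes [measurable]: "h \<in> borel_measurable borel" and r: "r > 0"
  shows "(\<integral>\<^sup>+s. h (s / sqrt (s\<^sup>2 + r\<^sup>2)) * indicator {s. s\<^sup>2 + r\<^sup>2 < 1} s \<partial>lborel)
    \<le> (\<integral>\<^sup>+t. h t * ennreal (1 / (1 - t\<^sup>2)) * indicator {t. r\<^sup>2 < 1 - t\<^sup>2} t \<partial>lborel)"
proof -
  define g where "g s = s / sqrt (s\<^sup>2 + r\<^sup>2)" for s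
  define g' where "g' s = r\<^sup>2 / ((s\<^sup>2 + r\<^sup>2) * sqrt (s\<^sup>2 + r\<^sup>2))" for s
  define f where "f t = h t * ennreal (1 / (1 - t\<^sup>2)) * indicator {t. r\<^sup>2 < 1 - t\<^sup>2} t" for t
  have pos: "s\<^sup>2 + r\<^sup>2 > 0" for s using r by (simp add: add_nonneg_pos)
  have [measurable]: "f \<in> borel_measurable borel" unfolding f_def by measurable
  \<comment> \<open>The substitution is carried out on the compact interval from -1 to 1, which
    contains every \<open>s\<close> with \<open>s\<^sup>2 + r\<^sup>2 < 1\<close>.\<close>
  have "(\<integral>\<^sup>+t. f t * indicator {g (-1)..g 1} t \<partial>lborel)
      = (\<integral>\<^sup>+s. f (g s) * g' s * indicator {-1..1} s \<partial>lborel)"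
  proof (rule nn_integral_substitution_aux)
    fix s :: real
    have "(g has_real_derivative (sqrt (s\<^sup>2 + r\<^sup>2) - s * (s / sqrt (s\<^sup>2 + r\<^sup>2))) / (s\<^sup>2 + r\<^sup>2)) (at s)"
      unfolding g_def using pos[of s]
      by (auto intro!: derivative_eq_intros simp: power2_eq_square field_simps)
    also have "sqrt (s\<^sup>2 + r\<^sup>2) - s * (s / sqrt (s\<^sup>2 + r\<^sup>2)) = r\<^sup>2 / sqrt (s\<^sup>2 + r\<^sup>2)"
    proof -
      have "sqrt (s\<^sup>2 + r\<^sup>2) > 0" "sqrt (s\<^sup>2 + r\<^sup>2) * sqrt (s\<^sup>2 + r\<^sup>2) = s\<^sup>2 + r\<^sup>2"
        using pos[of s] by simp_all
      then show ?thesis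
        by (simp add: eq_divide_eq left_diff_distrib power2_eq_square)
    qed
    finally show "(g has_real_derivative g' s) (at s)"
      by (simp add: g'_def mult.commute)
    show "g' s \<ge> 0" unfolding g'_def using pos[of s] by simp
    show "continuous_on {-1..1} g'"
      unfolding g'_def using pos by (intro continuous_intros) (auto simp: less_imp_neq[symmetric])
  qed auto
  moreover have "h (s / sqrt (s\<^sup>2 + r\<^sup>2)) * indicator {s. s\<^sup>2 + r\<^sup>2 < 1} s
      \<le> f (g s) * g' s * indicator {-1..1} s" for s
  proof (cases "s\<^sup>2 + r\<^sup>2 < 1")
    case True
    have sq: "(sqrt (s\<^sup>2 + r\<^sup>2))\<^sup>2 = s\<^sup>2 + r\<^sup>2" using pos[of s] by simp
    have g2: "1 - (g s)\<^sup>2 = r\<^sup>2 / (s\<^sup>2 + r\<^sup>2)"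
      using pos[of s] r unfolding g_def power_divide sq by (simp add: diff_divide_eq_iff divide_eq_eq eq_divide_eq)
    have "r\<^sup>2 * (s\<^sup>2 + r\<^sup>2) < r\<^sup>2 * 1" using True r by (intro mult_strict_left_mono) auto
    then have "r\<^sup>2 < 1 - (g s)\<^sup>2" unfolding g2 using pos[of s] by (simp add: field_simps)
    moreover have "s \<in> {-1..1}"
    proof -
      have "s\<^sup>2 \<le> 1" using True by (smt (verit) zero_le_power2)
      then show ?thesis by (simp add: abs_square_le_1 abs_le_iff)
    qed
    \<comment> \<open>Dividing the derivative by \<open>1 - (g s)\<^sup>2\<close> leaves
      \<open>1 / sqrt (s\<^sup>2 + r\<^sup>2)\<close>, which is at least 1 inside the ball; this is
      where the inequality enters.\<close>
    moreover have "1 \<le> 1 / (1 - (g s)\<^sup>2) * g' s"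
    proof -
      have "1 / (1 - (g s)\<^sup>2) * g' s = 1 / sqrt (s\<^sup>2 + r\<^sup>2)"
        unfolding g2 g'_def using pos[of s] r by simp
      also have "\<dots> \<ge> 1" using True pos[of s] by (simp add: real_sqrt_le_1_iff)
      finally show ?thesis .
    qed
    then have "ennreal 1 \<le> ennreal (1 / (1 - (g s)\<^sup>2) * g' s)" by (rule ennreal_leI)
    then have "1 \<le> ennreal (1 / (1 - (g s)\<^sup>2)) * ennreal (g' s)"
      using pos[of s] g2 by (subst ennreal_mult[symmetric]) (auto simp: g'_def)
    then have "h (g s) * 1 \<le> h (g s) * (ennreal (1 / (1 - (g s)\<^sup>2)) * ennreal (g' s))"
      by (intro mult_left_mono) auto
    ultimately show ?thesis using True by (simp add: f_def g_def[symmetric] mult.assoc)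
  qed simp
  ultimately have "(\<integral>\<^sup>+s. h (s / sqrt (s\<^sup>2 + r\<^sup>2)) * indicator {s. s\<^sup>2 + r\<^sup>2 < 1} s \<partial>lborel)
      \<le> (\<integral>\<^sup>+t. f t * indicator {g (-1)..g 1} t \<partial>lborel)"
    by (simp add: nn_integral_mono)
  also have "\<dots> \<le> (\<integral>\<^sup>+t. f t \<partial>lborel)"
    by (intro nn_integral_mono) (simp add: indicator_def)
  finally show ?thesis by (simp add: f_def)
qed

text \<open>The ball lies in a cube of side \<open>2 * R\<close>; only the order of growth in
  \<open>R\<close> matters below.\<close>

lemma emeasure_PiM_euclidean_ball_le:
  fixes I :: "'i set" and R :: real
  assumes I: "finite I" and R: "R > 0"
  shows "emeasure (Pi\<^sub>M I (\<lambda>_. lborel)) {y \<in> space (Pi\<^sub>M I (\<lambda>_. lborel)). (\<Sum>i\<in>I. (y i)\<^sup>2) < R\<^sup>2}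
    \<le> ennreal ((2 * R) ^ card I)"
proof -
  interpret product_sigma_finite "\<lambda>_ :: 'i. lborel :: real measure" by standard
  have "{y \<in> space (Pi\<^sub>M I (\<lambda>_. lborel)). (\<Sum>i\<in>I. (y i)\<^sup>2) < R\<^sup>2} \<subseteq> Pi\<^sub>E I (\<lambda>_. {-R..R})"
  proof (rule subsetI)
    fix y assume "y \<in> {y \<in> space (Pi\<^sub>M I (\<lambda>_. lborel :: real measure)). (\<Sum>i\<in>I. (y i)\<^sup>2) < R\<^sup>2}"
    then have y: "y \<in> space (Pi\<^sub>M I (\<lambda>_. lborel :: real measure))" "(\<Sum>i\<in>I. (y i)\<^sup>2) < R\<^sup>2"
      by simp_all
    have "y i \<in> {-R..R}" if "i \<in> I" for i
    proof -
      have "(y i)\<^sup>2 \<le> (\<Sum>i\<in>I. (y i)\<^sup>2)" using I that by (intro member_le_sum) auto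
      then have "(y i)\<^sup>2 \<le> R\<^sup>2" using y(2) by linarith
      then have "\<bar>y i\<bar> \<le> R" using R by (simp add: abs_le_square_iff[symmetric])
      then show ?thesis by (simp add: abs_le_iff)
    qed
    then show "y \<in> Pi\<^sub>E I (\<lambda>_. {-R..R})" using y(1) by (auto simp: space_PiM PiE_iff)
  qed
  then have "emeasure (Pi\<^sub>M I (\<lambda>_. lborel)) {y \<in> space (Pi\<^sub>M I (\<lambda>_. lborel)). (\<Sum>i\<in>I. (y i)\<^sup>2) < R\<^sup>2}
      \<le> emeasure (Pi\<^sub>M I (\<lambda>_. lborel)) (Pi\<^sub>E I (\<lambda>_. {-R..R}))"
    using I by (intro emeasure_mono sets_PiM_I_finite) auto
  also have "\<dots> = (\<Prod>i\<in>I. emeasure lborel {-R..R})"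
    using I by (intro emeasure_PiM) auto
  also have "\<dots> = ennreal ((2 * R) ^ card I)"
    using R by (simp add: ennreal_power)
  finally show ?thesis .
qed

text \<open>The ball is cut into lines parallel to \<open>e\<close>, on each of which the line
  estimate applies. After exchanging the integrals, the lines contributing at a given
  \<open>t\<close> are those at distance less than \<open>sqrt (1 - t\<^sup>2)\<close> from the
  axis, and their volume is bounded by that of a cube. The second direction \<open>b\<close>
  supplies a null hyperplane containing the axis.\<close>

lemma nn_integral_ball_sgn_inner_le:
  fixes e b :: "'a::euclidean_space" and h :: "real \<Rightarrow> ennreal"
  assumes h[measurable]: "h \<in> borel_measurable borel"
    and e: "e \<in> Basis" and b: "b \<in> Basis" "b \<noteq> e"
  shows "(\<integral>\<^sup>+z. h (e \<bullet> sgn z) * indicator (ball 0 1) z \<partial>lborel)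
    \<le> (\<integral>\<^sup>+t. h t * ennreal (1 / (1 - t\<^sup>2)) * (ennreal ((2 * sqrt (1 - t\<^sup>2)) ^ (DIM('a) - 1)) *
          indicator {-1<..<1} t) \<partial>lborel)"
proof -
  let ?B = "Basis - {e}"
  let ?M = "Pi\<^sub>M ?B (\<lambda>_. lborel :: real measure)"
  interpret product_sigma_finite "\<lambda>_ :: 'a. lborel :: real measure" by standard
  interpret B: finite_product_sigma_finite "\<lambda>_ :: 'a. lborel :: real measure" ?B by standard simp
  interpret L: pair_sigma_finite ?M "lborel :: real measure" ..
  have s: "sgn = (\<lambda>x::'a. x /\<^sub>R norm x)" by (auto simp: sgn_div_norm)
  have [measurable]: "(sgn :: 'a \<Rightarrow> 'a) \<in> borel_measurable borel" unfolding s by measurable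
  have [measurable]: "ball (0::'a) 1 \<in> sets borel" by (intro borel_open open_ball)
  define G where "G z = h (e \<bullet> sgn z) * indicator (ball 0 1) z * indicator {z. z \<bullet> b \<noteq> 0} z" for z
  have [measurable]: "G \<in> borel_measurable borel" unfolding G_def by measurable
  \<comment> \<open>\<open>v y s\<close> has coordinate \<open>s\<close> along \<open>e\<close> and
    the coordinates \<open>y\<close> in the other directions; \<open>q y\<close> is its squared
    distance from the axis.\<close>
  define v where "v y s = (\<Sum>i\<in>Basis. (y(e := s)) i *\<^sub>R i)" for y :: "'a \<Rightarrow> real" and s
  define q where "q y = (\<Sum>i\<in>?B. (y i)\<^sup>2)" for y :: "'a \<Rightarrow> real"
  have [measurable]: "q \<in> borel_measurable ?M" unfolding q_def by measurable
  define k where "k t = h t * ennreal (1 / (1 - t\<^sup>2))" for t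
  have [measurable]: "k \<in> borel_measurable borel" unfolding k_def by measurable
  \<comment> \<open>Off this null set the distance from the axis through \<open>e\<close> is positive.\<close>
  have "AE z in lborel. z \<bullet> b \<noteq> 0"
  proof (rule AE_I')
    have "{z. z \<bullet> b = 0} \<in> null_sets lebesgue"
      using negligible_standard_hyperplane[OF b(1), of 0] by (simp add: negligible_iff_null_sets)
    then show "{z. z \<bullet> b = 0} \<in> null_sets lborel"
      by (subst (asm) null_sets_completion_iff) auto
  qed auto
  then have "(\<integral>\<^sup>+z. h (e \<bullet> sgn z) * indicator (ball 0 1) z \<partial>lborel) = (\<integral>\<^sup>+z. G z \<partial>lborel)"
    by (intro nn_integral_cong_AE) (auto simp: G_def elim!: eventually_mono)
  also have "\<dots> = (\<integral>\<^sup>+z. G z \<partial>distr (\<Pi>\<^sub>M b\<in>Basis. lborel) borel (\<lambda>f. \<Sum>b\<in>Basis. f b *\<^sub>R b))"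
    by (rule arg_cong[where f="\<lambda>M. integral\<^sup>N M G", OF lborel_eq])
  also have "\<dots> = (\<integral>\<^sup>+f. G (\<Sum>b\<in>Basis. f b *\<^sub>R b) \<partial>(\<Pi>\<^sub>M b\<in>insert e ?B. lborel))"
    using e by (subst nn_integral_distr) (simp_all add: insert_absorb)
  also have "\<dots> = (\<integral>\<^sup>+y. (\<integral>\<^sup>+s. G (v y s) \<partial>lborel) \<partial>?M)"
    unfolding v_def
    using e by (intro product_nn_integral_insert) (simp_all add: insert_absorb)
  also have "\<dots> \<le> (\<integral>\<^sup>+y. (\<integral>\<^sup>+t. k t * indicator {t. q y < 1 - t\<^sup>2} t \<partial>lborel) \<partial>?M)"
  proof (rule nn_integral_mono)
    fix y
    have v_inner: "v y s \<bullet> i = (y(e := s)) i" if "i \<in> Basis" for s i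
      unfolding v_def using that by (rule inner_sum_left_Basis)
    have v_norm: "norm (v y s) = sqrt (s\<^sup>2 + q y)" for s
    proof -
      have "v y s \<bullet> v y s = (\<Sum>i\<in>Basis. ((y(e := s)) i)\<^sup>2)"
        by (subst euclidean_inner) (simp add: v_inner power2_eq_square)
      also have "\<dots> = s\<^sup>2 + (\<Sum>i\<in>?B. ((y(e := s)) i)\<^sup>2)"
        using e by (subst sum.remove[of _ e]) auto
      also have "(\<Sum>i\<in>?B. ((y(e := s)) i)\<^sup>2) = q y"
        unfolding q_def by (rule sum.cong) auto
      finally show ?thesis by (simp add: norm_eq_sqrt_inner)
    qed
    show "(\<integral>\<^sup>+s. G (v y s) \<partial>lborel) \<le> (\<integral>\<^sup>+t. k t * indicator {t. q y < 1 - t\<^sup>2} t \<partial>lborel)"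
    proof (cases "y b = 0")
      case True
      then show ?thesis using b by (simp add: G_def v_inner)
    next
      case False
      have "(y b)\<^sup>2 \<le> q y" unfolding q_def using b by (intro member_le_sum) auto
      then have q: "q y > 0" using False by (smt (verit) zero_less_power2)
      have G: "G (v y s) = h (s / sqrt (s\<^sup>2 + (sqrt (q y))\<^sup>2)) * indicator {s. s\<^sup>2 + (sqrt (q y))\<^sup>2 < 1} s" for s
        using b e q False
        by (simp add: G_def v_inner v_norm sgn_div_norm inner_commute[of e] indicator_def divide_inverse mult.commute)
      show ?thesis
        unfolding G k_def
        using nn_integral_projection_line_le[OF h, of "sqrt (q y)"] q by simp
    qed
  qed
  also have "\<dots> = (\<integral>\<^sup>+t. (\<integral>\<^sup>+y. k t * indicator {t. q y < 1 - t\<^sup>2} t \<partial>?M) \<partial>lborel)"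
    by (rule L.Fubini'[symmetric]) measurable
  also have "\<dots> \<le> (\<integral>\<^sup>+t. k t * (ennreal ((2 * sqrt (1 - t\<^sup>2)) ^ (DIM('a) - 1)) * indicator {-1<..<1} t) \<partial>lborel)"
  proof (rule nn_integral_mono)
    fix t :: real
    have "(\<integral>\<^sup>+y. k t * indicator {t. q y < 1 - t\<^sup>2} t \<partial>?M)
        = k t * (\<integral>\<^sup>+y. indicator {y \<in> space ?M. q y < 1 - t\<^sup>2} y \<partial>?M)"
      by (subst nn_integral_cmult[symmetric]) (auto intro!: nn_integral_cong simp: indicator_def)
    also have "(\<integral>\<^sup>+y. indicator {y \<in> space ?M. q y < 1 - t\<^sup>2} y \<partial>?M)
        = emeasure ?M {y \<in> space ?M. q y < 1 - t\<^sup>2}"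
      by (rule nn_integral_indicator) measurable
    \<comment> \<open>For |t| < 1 the set is a Euclidean ball in one dimension less; otherwise it is
      empty because \<open>q\<close> is nonnegative.\<close>
    also have "\<dots> \<le> ennreal ((2 * sqrt (1 - t\<^sup>2)) ^ (DIM('a) - 1)) * indicator {-1<..<1} t"
    proof (cases "t \<in> {-1<..<1}")
      case True
      then have "1 - t\<^sup>2 > 0" by (simp add: abs_square_less_1 abs_less_iff)
      then show ?thesis
        using emeasure_PiM_euclidean_ball_le[of ?B "sqrt (1 - t\<^sup>2)"] e True
        by (simp add: q_def card_Diff_singleton)
    next
      case False
      then have "1 - t\<^sup>2 \<le> 0"
        using abs_square_less_1[of t] by (auto simp: abs_less_iff not_less)
      moreover have q_nonneg: "q y \<ge> 0" for y unfolding q_def by (simp add: sum_nonneg)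
      ultimately have "\<not> q y < 1 - t\<^sup>2" for y using q_nonneg[of y] by linarith
      then have empty: "{y \<in> space ?M. q y < 1 - t\<^sup>2} = {}" by blast
      show ?thesis unfolding empty by simp
    qed
    finally show "(\<integral>\<^sup>+y. k t * indicator {t. q y < 1 - t\<^sup>2} t \<partial>?M)
      \<le> k t * (ennreal ((2 * sqrt (1 - t\<^sup>2)) ^ (DIM('a) - 1)) * indicator {-1<..<1} t)"
      by (simp add: mult_left_mono)
  qed
  finally show ?thesis unfolding k_def .
qed

text \<open>By invariance \<open>x\<close> may be replaced by a basis vector. The cross sections
  contribute \<open>(1 - t\<^sup>2) powr (d/2)\<close> and the line substitution the factor
  \<open>1 / (1 - t\<^sup>2)\<close>.\<close>

lemma nn_integral_sphere_sigma_inner_le: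
  fixes x :: "'a::euclidean_space" and h :: "real \<Rightarrow> ennreal"
  assumes h[measurable]: "h \<in> borel_measurable borel"
    and dim: "DIM('a) = d + 1" "d \<ge> 1" and x: "norm x = 1"
  shows "(\<integral>\<^sup>+z. h (x \<bullet> z) \<partial>sphere_sigma)
    \<le> ennreal (2 ^ d) / emeasure lborel (ball (0::'a) 1) *
      (\<integral>\<^sup>+t. h t * ennreal ((1 - t\<^sup>2) powr (real d / 2 - 1)) * indicator {-1..1} t \<partial>lborel)"
proof -
  let ?V = "emeasure lborel (ball (0::'a) 1)"
  obtain e :: 'a where e: "e \<in> Basis" using nonempty_Basis by blast
  \<comment> \<open>The dimension is at least 2, so a basis vector other than \<open>e\<close>
    exists.\<close>
  have "\<not> (Basis :: 'a set) \<subseteq> {e}"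
    using card_mono[of "{e}" "Basis :: 'a set"] dim by auto
  then obtain b where b: "b \<in> Basis" "b \<noteq> e" by blast
  have "(\<integral>\<^sup>+z. h (e \<bullet> sgn z) * indicator (ball 0 1) z \<partial>lborel)
    \<le> (\<integral>\<^sup>+t. h t * ennreal (1 / (1 - t\<^sup>2)) * (ennreal ((2 * sqrt (1 - t\<^sup>2)) ^ (DIM('a) - 1)) *
          indicator {-1<..<1} t) \<partial>lborel)"
    by (rule nn_integral_ball_sgn_inner_le[OF h e b])
  also have "\<dots> \<le> (\<integral>\<^sup>+t. ennreal (2 ^ d) * (h t * ennreal ((1 - t\<^sup>2) powr (real d / 2 - 1)) * indicator {-1..1} t) \<partial>lborel)"
  proof (rule nn_integral_mono)
    fix t :: real
    show "h t * ennreal (1 / (1 - t\<^sup>2)) * (ennreal ((2 * sqrt (1 - t\<^sup>2)) ^ (DIM('a) - 1)) * indicator {-1<..<1} t)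
      \<le> ennreal (2 ^ d) * (h t * ennreal ((1 - t\<^sup>2) powr (real d / 2 - 1)) * indicator {-1..1} t)"
    proof (cases "t \<in> {-1<..<1}")
      case True
      define u where "u = 1 - t\<^sup>2"
      have u: "u > 0" using True by (simp add: u_def abs_square_less_1 abs_less_iff)
      have "sqrt u ^ d = u powr (real d / 2)"
        using u by (simp add: powr_half_sqrt[symmetric] powr_power)
      then have "1 / u * (2 * sqrt u) ^ d = 2 ^ d * u powr (real d / 2 - 1)"
        using u by (simp add: power_mult_distrib powr_diff)
      then have "ennreal (1 / u) * ennreal ((2 * sqrt u) ^ d) = ennreal (2 ^ d) * ennreal (u powr (real d / 2 - 1))"
        using u by (simp add: ennreal_mult[symmetric] del: ennreal_power)
      then show ?thesis
        using True dim by (simp add: u_def mult_ac)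
    qed simp
  qed
  also have "\<dots> = ennreal (2 ^ d) * (\<integral>\<^sup>+t. h t * ennreal ((1 - t\<^sup>2) powr (real d / 2 - 1)) * indicator {-1..1} t \<partial>lborel)"
    by (rule nn_integral_cmult) measurable
  finally have le: "(\<integral>\<^sup>+z. h (e \<bullet> sgn z) * indicator (ball 0 1) z \<partial>lborel) \<le> \<dots>" .
  have "(\<integral>\<^sup>+z. h (x \<bullet> z) \<partial>sphere_sigma) = (\<integral>\<^sup>+z. h (e \<bullet> z) \<partial>sphere_sigma)"
    using x e by (intro nn_integral_sphere_sigma_inner h) simp
  also have "\<dots> = (\<integral>\<^sup>+z. h (e \<bullet> sgn z) * indicator (ball 0 1) z \<partial>lborel) / ?V"
    by (subst nn_integral_sphere_sigma) auto
  also have "\<dots> \<le> ennreal (2 ^ d) * (\<integral>\<^sup>+t. h t * ennreal ((1 - t\<^sup>2) powr (real d / 2 - 1)) * indicator {-1..1} t \<partial>lborel) / ?V"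
    by (rule divide_right_mono_ennreal[OF le])
  also have "\<dots> = ennreal (2 ^ d) / ?V *
      (\<integral>\<^sup>+t. h t * ennreal ((1 - t\<^sup>2) powr (real d / 2 - 1)) * indicator {-1..1} t \<partial>lborel)"
    by (simp only: mult.commute[of "ennreal (2 ^ d) / ?V"] ennreal_times_divide mult.commute[of _ "ennreal (2 ^ d)"])
  finally show ?thesis .
qed

section \<open>Energy and discrepancy\<close>

lemma
  fixes f g :: "'a \<Rightarrow> real"
  assumes g: "g \<in> borel_measurable M" and eq: "AE x in M. f x = g x"
  shows integrable_completion_AE: "integrable (completion M) f \<longleftrightarrow> integrable M g"
    and integral_completion_AE: "(LINT x|completion M. f x) = (LINT x|M. g x)"
proof -
  obtain N where N: "N \<in> null_sets M" "{x \<in> space M. f x \<noteq> g x} \<subseteq> N"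
    using eq unfolding eventually_ae_filter by blast
  have f: "f \<in> borel_measurable (completion M)"
  proof (rule measurableI)
    fix A :: "real set" assume A: "A \<in> sets borel"
    \<comment> \<open>The preimages under \<open>f\<close> and \<open>g\<close> differ only inside
      the null set \<open>N\<close>, all of whose subsets are measurable for the completion.\<close>
    have eq: "f -` A \<inter> space M = (g -` A \<inter> space M - N) \<union> (f -` A \<inter> space M \<inter> N)"
      using N(2) by auto
    show "f -` A \<inter> space (completion M) \<in> sets (completion M)"
      unfolding space_completion
    proof (subst eq, rule sets.Un)
      show "g -` A \<inter> space M - N \<in> sets (completion M)"
        using measurable_sets[OF g A] N(1) by (intro sets_completionI_sets) auto
      show "f -` A \<inter> space M \<inter> N \<in> sets (completion M)"
        by (rule null_sets_completion[OF N(1)]) blast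
    qed
  qed simp
  have g': "g \<in> borel_measurable (completion M)" by (rule measurable_completion[OF g])
  have eq': "AE x in completion M. f x = g x" by (rule AE_completion[OF eq])
  show "integrable (completion M) f \<longleftrightarrow> integrable M g"
    using integrable_cong_AE[OF f g' eq'] integrable_completion[OF g] by simp
  show "(LINT x|completion M. f x) = (LINT x|M. g x)"
    using integral_cong_AE[OF f g' eq'] integral_completion[OF g] by simp
qed

lemma signed_integral_borel:
  assumes "g \<in> borel_measurable M"
  shows "signed_integral M \<nu> g = (LINT x|pos_variation M \<nu>. g x) - (LINT x|neg_variation M \<nu>. g x)"
proof -
  have "g \<in> borel_measurable (pos_variation M \<nu>)" "g \<in> borel_measurable (neg_variation M \<nu>)"
    using assms by (simp_all cong: measurable_cong_sets)
  then show ?thesis by (simp add: signed_integral_def integral_completion)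
qed

lemma signed_integral_cong:
  assumes "\<And>x. x \<in> space M \<Longrightarrow> f x = g x"
  shows "signed_integral M \<nu> f = signed_integral M \<nu> g"
  using assms unfolding signed_integral_def
  by (intro arg_cong2[where f="(-)"] Bochner_Integration.integral_cong) simp_all

section \<open>Fubini for kernels with uniformly square integrable slices\<close>

text \<open>The bound is required at every \<open>x\<close>, not merely almost every one: the slices
  will be integrated against measures, such as point masses, that may charge \<open>S\<close>-null
  sets.\<close>

locale square_integrable_kernel = finite_measure S for S :: "'a measure" +
  fixes K :: "'a \<times> 'a \<Rightarrow> real" and C :: ennreal
  assumes K[measurable]: "K \<in> borel_measurable (S \<Otimes>\<^sub>M S)"
    and bound: "\<And>x. x \<in> space S \<Longrightarrow> (\<integral>\<^sup>+z. ennreal ((K (z, x))\<^sup>2) \<partial>S) \<le> C"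
    and C: "C < top"
begin

text \<open>The triple kernel \<open>K (z, x) * K (z, y)\<close> is dominated by the sum of the two
  squares, whose integrals over \<open>z\<close> are at most \<open>C\<close> each. It is therefore
  integrable over the product of all three finite measures, and the three claims are instances of
  Fubini.\<close>

lemma
  assumes P: "finite_measure P" and sets_P[measurable_cong]: "sets P = sets S"
    and Q: "finite_measure Q" and sets_Q[measurable_cong]: "sets Q = sets S"
  shows integrable_potential_product:
      "integrable S (\<lambda>z. (LINT x|P. K (z, x)) * (LINT y|Q. K (z, y)))"
    and integrable_iterated_kernel:
      "integrable (P \<Otimes>\<^sub>M Q) (\<lambda>(x, y). LINT z|S. K (z, x) * K (z, y))"
    and integral_iterated_kernel:
      "(LINT y|Q. (LINT x|P. (LINT z|S. K (z, x) * K (z, y))))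
        = (LINT z|S. (LINT x|P. K (z, x)) * (LINT y|Q. K (z, y)))"
proof -
  let ?T = "\<lambda>(z, x, y). K (z, x) * K (z, y)"
  interpret P: finite_measure P by (rule P)
  interpret Q: finite_measure Q by (rule Q)
  interpret PQ: pair_sigma_finite P Q ..
  interpret PQ': finite_measure "P \<Otimes>\<^sub>M Q" by (rule finite_measure_pair_measure[OF Q P])
  interpret T: pair_sigma_finite S "P \<Otimes>\<^sub>M Q" ..
  have spaces: "space P = space S" "space Q = space S"
    using sets_P sets_Q by (auto dest: sets_eq_imp_space_eq)
  have bound_T: "norm (?T (z, w)) \<le> (K (z, fst w))\<^sup>2 + (K (z, snd w))\<^sup>2" for z w
  proof -
    have "\<bar>K (z, fst w)\<bar> * \<bar>K (z, snd w)\<bar> \<le> 2 * \<bar>K (z, fst w)\<bar> * \<bar>K (z, snd w)\<bar>" by simp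
    also have "\<dots> \<le> \<bar>K (z, fst w)\<bar>\<^sup>2 + \<bar>K (z, snd w)\<bar>\<^sup>2" by (rule sum_squares_bound)
    finally have "\<bar>K (z, fst w)\<bar> * \<bar>K (z, snd w)\<bar> \<le> (K (z, fst w))\<^sup>2 + (K (z, snd w))\<^sup>2"
      by (simp only: power2_abs)
    then show ?thesis by (simp add: split_beta abs_mult)
  qed
  have int_T: "integrable (S \<Otimes>\<^sub>M (P \<Otimes>\<^sub>M Q)) ?T"
  proof (rule integrableI_bounded)
    show "?T \<in> borel_measurable (S \<Otimes>\<^sub>M (P \<Otimes>\<^sub>M Q))" by measurable
    have "(\<integral>\<^sup>+u. norm (?T u) \<partial>(S \<Otimes>\<^sub>M (P \<Otimes>\<^sub>M Q)))
      = (\<integral>\<^sup>+w. (\<integral>\<^sup>+z. norm (?T (z, w)) \<partial>S) \<partial>(P \<Otimes>\<^sub>M Q))"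
      by (rule T.nn_integral_snd[symmetric]) measurable
    also have "\<dots> \<le> (\<integral>\<^sup>+w. C + C \<partial>(P \<Otimes>\<^sub>M Q))"
    proof (rule nn_integral_mono)
      fix w assume w: "w \<in> space (P \<Otimes>\<^sub>M Q)"
      then have w': "fst w \<in> space S" "snd w \<in> space S" by (auto simp: space_pair_measure spaces)
      have "(\<integral>\<^sup>+z. norm (?T (z, w)) \<partial>S) \<le> (\<integral>\<^sup>+z. ennreal ((K (z, fst w))\<^sup>2) + ennreal ((K (z, snd w))\<^sup>2) \<partial>S)"
        using bound_T by (intro nn_integral_mono) (simp add: ennreal_plus[symmetric] ennreal_leI del: ennreal_plus)
      also have "\<dots> = (\<integral>\<^sup>+z. ennreal ((K (z, fst w))\<^sup>2) \<partial>S) + (\<integral>\<^sup>+z. ennreal ((K (z, snd w))\<^sup>2) \<partial>S)"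
        using w' by (intro nn_integral_add) measurable
      also have "\<dots> \<le> C + C" by (intro add_mono bound w')
      finally show "(\<integral>\<^sup>+z. norm (?T (z, w)) \<partial>S) \<le> C + C" .
    qed
    also have "\<dots> = (C + C) * emeasure (P \<Otimes>\<^sub>M Q) (space (P \<Otimes>\<^sub>M Q))" by simp
    also have "\<dots> < \<infinity>"
      using C PQ'.emeasure_finite by (simp add: less_top[symmetric] ennreal_mult_eq_top_iff ennreal_add_eq_top)
    finally show "(\<integral>\<^sup>+u. norm (?T u) \<partial>(S \<Otimes>\<^sub>M (P \<Otimes>\<^sub>M Q))) < \<infinity>" .
  qed
  have int_T': "integrable (S \<Otimes>\<^sub>M (P \<Otimes>\<^sub>M Q)) (\<lambda>(z, w). ?T (z, w))" using int_T by simp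
  have inner: "AE z in S. (LINT w|(P \<Otimes>\<^sub>M Q). ?T (z, w)) = (LINT x|P. K (z, x)) * (LINT y|Q. K (z, y))"
    using T.AE_integrable_fst'[OF int_T]
  proof eventually_elim
    fix z assume z: "integrable (P \<Otimes>\<^sub>M Q) (\<lambda>w. ?T (z, w))"
    have "(LINT w|(P \<Otimes>\<^sub>M Q). ?T (z, w)) = (LINT x|P. (LINT y|Q. ?T (z, x, y)))"
      by (rule PQ.integral_fst'[OF z, symmetric])
    \<comment> \<open>Constant factors leave both integrals even without integrability, since a
      nonintegrable function has integral 0.\<close>
    also have "\<dots> = (LINT x|P. K (z, x)) * (LINT y|Q. K (z, y))" by simp
    finally show "(LINT w|(P \<Otimes>\<^sub>M Q). ?T (z, w)) = (LINT x|P. K (z, x)) * (LINT y|Q. K (z, y))" .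
  qed
  have meas: "(\<lambda>z. LINT w|(P \<Otimes>\<^sub>M Q). ?T (z, w)) \<in> borel_measurable S"
    "(\<lambda>z. (LINT x|P. K (z, x)) * (LINT y|Q. K (z, y))) \<in> borel_measurable S"
    by measurable
  show "integrable S (\<lambda>z. (LINT x|P. K (z, x)) * (LINT y|Q. K (z, y)))"
    using T.integrable_fst'[OF int_T] integrable_cong_AE[OF meas inner] by simp
  show int_H: "integrable (P \<Otimes>\<^sub>M Q) (\<lambda>(x, y). LINT z|S. K (z, x) * K (z, y))"
    using T.integrable_snd[OF int_T'] by (simp add: case_prod_unfold)
  have "(LINT y|Q. (LINT x|P. (LINT z|S. K (z, x) * K (z, y))))
      = (LINT w|(P \<Otimes>\<^sub>M Q). (LINT z|S. ?T (z, w)))"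
    using PQ.integral_snd[OF int_H] by (simp add: case_prod_unfold)
  also have "\<dots> = (LINT z|S. (LINT w|(P \<Otimes>\<^sub>M Q). ?T (z, w)))"
    by (rule T.Fubini_integral[OF int_T'])
  also have "\<dots> = (LINT z|S. (LINT x|P. K (z, x)) * (LINT y|Q. K (z, y)))"
    by (rule integral_cong_AE[OF meas inner])
  finally show "(LINT y|Q. (LINT x|P. (LINT z|S. K (z, x) * K (z, y))))
        = (LINT z|S. (LINT x|P. K (z, x)) * (LINT y|Q. K (z, y)))" .
qed

text \<open>The uniform bound makes \<open>K\<close> square integrable on a finite product measure,
  hence integrable.\<close>

lemma integrable_kernel:
  assumes P: "finite_measure P" and sets_P[measurable_cong]: "sets P = sets S"
  shows "integrable (S \<Otimes>\<^sub>M P) K"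
proof -
  interpret P: finite_measure P by (rule P)
  interpret T: pair_sigma_finite S P ..
  interpret T': finite_measure "S \<Otimes>\<^sub>M P" by (rule finite_measure_pair_measure[OF P finite_measure_axioms])
  have space_P: "space P = space S" using sets_P by (rule sets_eq_imp_space_eq)
  have meas: "K \<in> borel_measurable (S \<Otimes>\<^sub>M P)" by measurable
  have "integrable (S \<Otimes>\<^sub>M P) (\<lambda>u. (K u)\<^sup>2)"
  proof (rule integrableI_bounded)
    have "(\<integral>\<^sup>+u. norm ((K u)\<^sup>2) \<partial>(S \<Otimes>\<^sub>M P)) = (\<integral>\<^sup>+x. (\<integral>\<^sup>+z. norm ((K (z, x))\<^sup>2) \<partial>S) \<partial>P)"
      by (rule T.nn_integral_snd[symmetric]) measurable
    also have "\<dots> \<le> (\<integral>\<^sup>+x. C \<partial>P)"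
      using bound by (intro nn_integral_mono) (simp add: space_P)
    also have "\<dots> = C * emeasure P (space P)" by simp
    also have "\<dots> < \<infinity>"
      using C P.emeasure_finite by (simp add: less_top[symmetric] ennreal_mult_eq_top_iff)
    finally show "(\<integral>\<^sup>+u. norm ((K u)\<^sup>2) \<partial>(S \<Otimes>\<^sub>M P)) < \<infinity>" .
  qed measurable
  with meas show ?thesis by (rule T'.square_integrable_imp_integrable)
qed

end

section \<open>Zonal kernels on the sphere\<close>

text \<open>The exceptional set is kept explicitly as a Borel null set on the line, because it is
  later pulled back along \<open>(x, y) \<mapsto> x \<bullet> y\<close>.\<close>

lemma weighted_L2_borel_representative:
  assumes f: "f \<in> weighted_L2 l"
  obtains g N where "g \<in> borel_measurable borel" "N \<in> null_sets lborel"
    "\<forall>t\<in>{-1..1} - N. f t = g t"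
    "(\<integral>\<^sup>+t. ennreal ((g t)\<^sup>2) * ennreal ((1 - t\<^sup>2) powr (l - 1/2)) * indicator {-1..1} t \<partial>lborel) < top"
proof -
  have "(\<lambda>t. indicator {-1..1} t *\<^sub>R f t) \<in> borel_measurable lebesgue"
    using f unfolding weighted_L2_def by (subst borel_measurable_restrict_space_iff[symmetric]) auto
  from completion_ex_borel_measurable_real[OF this]
  obtain g where g: "g \<in> borel_measurable lborel" "AE t in lborel. indicator {-1..1} t *\<^sub>R f t = g t" ..
  obtain N where N: "N \<in> null_sets lborel" "{t \<in> space lborel. indicator {-1..1} t *\<^sub>R f t \<noteq> g t} \<subseteq> N"
    using g(2) unfolding eventually_ae_filter by blast
  have "integrable lebesgue (\<lambda>t. indicator {-1..1} t *\<^sub>R (\<bar>f t\<bar>\<^sup>2 * (1 - t\<^sup>2) powr (l - 1/2)))"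
    using f unfolding weighted_L2_def by (subst integrable_restrict_space[symmetric]) auto
  then have "(\<integral>\<^sup>+t. norm (indicator {-1..1} t *\<^sub>R (\<bar>f t\<bar>\<^sup>2 * (1 - t\<^sup>2) powr (l - 1/2))) \<partial>lborel) < top"
    unfolding integrable_iff_bounded nn_integral_completion by simp
  also have "(\<integral>\<^sup>+t. norm (indicator {-1..1} t *\<^sub>R (\<bar>f t\<bar>\<^sup>2 * (1 - t\<^sup>2) powr (l - 1/2))) \<partial>lborel)
    = (\<integral>\<^sup>+t. ennreal ((g t)\<^sup>2) * ennreal ((1 - t\<^sup>2) powr (l - 1/2)) * indicator {-1..1} t \<partial>lborel)"
    using g(2) by (intro nn_integral_cong_AE) (auto elim!: eventually_mono simp: indicator_def ennreal_mult[symmetric])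
  finally have fin: "(\<integral>\<^sup>+t. ennreal ((g t)\<^sup>2) * ennreal ((1 - t\<^sup>2) powr (l - 1/2)) * indicator {-1..1} t \<partial>lborel) < top" .
  show ?thesis
  proof (rule that[OF _ N(1) _ fin])
    show "g \<in> borel_measurable borel" using g(1) by simp
    show "\<forall>t\<in>{-1..1} - N. f t = g t"
    proof
      fix t assume t: "t \<in> {-1..1} - N"
      then have "t \<notin> {t \<in> space lborel. indicator {-1..1} t *\<^sub>R f t \<noteq> g t}" using N(2) by blast
      then show "f t = g t" using t by simp
    qed
  qed
qed


lemma sets_sphere_sigma [simp, measurable_cong]: "sets sphere_sigma = sets sphere_borel"
  and space_sphere_sigma [simp]: "space sphere_sigma = unit_sphere"
  by (simp_all add: sphere_sigma_def space_restrict_space)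

lemma sphere_inner_kernel_measurable:
  fixes h :: "real \<Rightarrow> 'b::topological_space"
  assumes [measurable]: "h \<in> borel_measurable borel"
  shows "(\<lambda>(x, y). h (x \<bullet> y)) \<in>
    borel_measurable (sphere_borel \<Otimes>\<^sub>M (sphere_borel :: 'a::euclidean_space measure))"
proof -
  have id: "(\<lambda>x. x) \<in> measurable sphere_borel (borel :: 'a measure)"
    by (rule measurable_restrict_space1) simp
  have "(\<lambda>w. fst w \<bullet> snd w) \<in> borel_measurable (sphere_borel \<Otimes>\<^sub>M (sphere_borel :: 'a measure))"
    by (rule borel_measurable_inner[OF measurable_compose[OF measurable_fst id] measurable_compose[OF measurable_snd id]])
  from measurable_compose[OF this assms] show ?thesis by (simp add: split_beta)
qed

text \<open>Invariance of nonnegative integrals restated as equality of image measures, so that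
  integrals of real functions agree without any question of convergence.\<close>

lemma distr_sphere_sigma_inner:
  fixes x e :: "'a::euclidean_space"
  assumes "norm x = norm e"
  shows "distr sphere_sigma borel (\<lambda>z. x \<bullet> z) = distr sphere_sigma borel (\<lambda>z. e \<bullet> z)"
proof (rule measure_eqI)
  have inner: "(\<lambda>z. u \<bullet> z) \<in> borel_measurable sphere_sigma" for u :: 'a
    by (subst measurable_cong_sets[OF sets_sphere_sigma refl], rule measurable_restrict_space1) simp
  fix A assume "A \<in> sets (distr sphere_sigma borel (\<lambda>z. x \<bullet> z))"
  then have A[measurable]: "A \<in> sets borel" by simp
  have eq: "emeasure (distr sphere_sigma borel (\<lambda>z. u \<bullet> z)) A = (\<integral>\<^sup>+z. indicator A (u \<bullet> z) \<partial>sphere_sigma)" for u :: 'a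
    by (subst nn_integral_distr[OF inner, of "indicator A", symmetric]) simp_all
  show "emeasure (distr sphere_sigma borel (\<lambda>z. x \<bullet> z)) A = emeasure (distr sphere_sigma borel (\<lambda>z. e \<bullet> z)) A"
    unfolding eq by (rule nn_integral_sphere_sigma_inner[OF _ assms]) simp
qed simp

lemma energy_measure:
  fixes F :: "real \<Rightarrow> real" and R :: "'a::euclidean_space measure"
  assumes R: "finite_measure R" "sets R = sets sphere_borel"
    and \<nu>: "\<And>A. A \<in> sets sphere_borel \<Longrightarrow> \<nu> A = measure R A"
    and F: "(\<lambda>(x, y). F (x \<bullet> y)) \<in> borel_measurable (sphere_borel \<Otimes>\<^sub>M (sphere_borel :: 'a measure))"
  shows "energy F \<nu> = (LINT y|R. (LINT x|R. F (x \<bullet> y)))"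
proof -
  interpret R: finite_measure R by (rule R)
  have "energy F \<nu> = signed_integral sphere_borel \<nu> (\<lambda>y. LINT x|R. F (x \<bullet> y))"
    unfolding energy_def
  proof (rule signed_integral_cong)
    fix y :: 'a assume y: "y \<in> space sphere_borel"
    have slice: "(\<lambda>x. F (x \<bullet> y)) \<in> borel_measurable sphere_borel"
      using measurable_Pair1[OF F y] by simp
    show "signed_integral sphere_borel \<nu> (\<lambda>x. F (x \<bullet> y)) = (LINT x|R. F (x \<bullet> y))"
      by (rule signed_integral_measure[OF R _ slice]) (rule \<nu>)
  qed
  also have "\<dots> = (LINT y|R. (LINT x|R. F (x \<bullet> y)))"
  proof (rule signed_integral_measure[OF R])
    show "\<nu> A = measure R A" if "A \<in> sets sphere_borel" for A using that by (rule \<nu>)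
    have "(\<lambda>(y, x). F (y \<bullet> x)) \<in> borel_measurable (sphere_borel \<Otimes>\<^sub>M R)"
      using F R(2) by (simp cong: measurable_cong_sets sets_pair_measure_cong)
    then show "(\<lambda>y. LINT x|R. F (x \<bullet> y)) \<in> borel_measurable sphere_borel"
      by (subst inner_commute) (rule R.borel_measurable_lebesgue_integral)
  qed
  finally show ?thesis .
qed

section \<open>The identity for signed measures\<close>

text \<open>The four claims share one construction: a Borel kernel \<open>K\<close> replacing
  \<open>f\<close>, its iterate \<open>H\<close> replacing \<open>F\<close>, and the potentials of
  the two Jordan parts and of the surface measure.\<close>

lemma
  fixes \<mu> :: "'a::euclidean_space set \<Rightarrow> real" and F f :: "real \<Rightarrow> real"
  assumes dim: "DIM('a) = d + 1" "d \<ge> 1"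
    and \<mu>: "finite_signed_measure sphere_borel \<mu>" and mass: "\<mu> unit_sphere = 1"
    and f: "f \<in> weighted_L2 ((real d - 1) / 2)"
    and F: "\<And>x y :: 'a. x \<in> unit_sphere \<Longrightarrow> y \<in> unit_sphere \<Longrightarrow>
           F (x \<bullet> y) = (LINT z|completion sphere_sigma. f (x \<bullet> z) * f (z \<bullet> y))"
  shows AE_discrepancy_integrable: "AE x in sphere_sigma.
            signed_integrable sphere_borel \<mu> (\<lambda>y. f (x \<bullet> y)) \<and>
            integrable (completion sphere_sigma) (\<lambda>y. f (x \<bullet> y))" (is ?AE)
    and integrable_discrepancy_square:
      "integrable (completion sphere_sigma) (\<lambda>x. \<bar>discrepancy_at f \<mu> x\<bar>\<^sup>2)" (is ?int)
    and energy_eq_discrepancy: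
      "energy F \<mu> - energy F (measure (sphere_sigma :: 'a measure)) = (L2_discrepancy f \<mu>)\<^sup>2" (is ?eq)
    and energy_kernel_measurable:
      "(\<lambda>(x, y). F (x \<bullet> y)) \<in> borel_measurable (sphere_borel \<Otimes>\<^sub>M (sphere_borel :: 'a measure))" (is ?meas)
proof -
  obtain g N where g[measurable]: "g \<in> borel_measurable borel" and N: "N \<in> null_sets lborel"
    and fg: "\<forall>t\<in>{-1..1} - N. f t = g t"
    and g_fin: "(\<integral>\<^sup>+t. ennreal ((g t)\<^sup>2) * ennreal ((1 - t\<^sup>2) powr ((real d - 1) / 2 - 1/2)) *
        indicator {-1..1} t \<partial>lborel) < top"
    by (rule weighted_L2_borel_representative[OF f])
  have [measurable]: "N \<in> sets borel" using N by auto
  let ?S = "sphere_sigma :: 'a measure"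
  let ?c = "ennreal (2 ^ d) / emeasure lborel (ball (0::'a) 1)"
  define K where "K = (\<lambda>(x :: 'a, y). g (x \<bullet> y))"
  have K_apply: "K (x, y) = g (x \<bullet> y)" for x y by (simp add: K_def)
  define C where "C = ?c * (\<integral>\<^sup>+t. ennreal ((g t)\<^sup>2) * ennreal ((1 - t\<^sup>2) powr (real d / 2 - 1)) *
        indicator {-1..1} t \<partial>lborel)"
  have "?c < top"
  proof -
    have "emeasure lborel (ball (0::'a) 1) \<noteq> 0"
      using content_ball_pos[of 1 "0::'a"] by (auto simp: measure_def)
    then show ?thesis by (simp add: less_top[symmetric] ennreal_divide_eq_top_iff)
  qed
  \<comment> \<open>The exponent of the weight in the hypothesis on \<open>f\<close> is exactly that
    of the zonal bound.\<close>
  moreover have exponent: "(real d - 1) / 2 - 1/2 = real d / 2 - 1" by (simp add: field_simps)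
  ultimately have C: "C < top"
    using g_fin unfolding C_def exponent by (simp add: less_top[symmetric] ennreal_mult_eq_top_iff)
  interpret S: prob_space ?S by (rule prob_space_sphere_sigma)
  have K[measurable]: "K \<in> borel_measurable (?S \<Otimes>\<^sub>M ?S)"
    using sphere_inner_kernel_measurable[OF g, where 'a='a] by (simp add: K_def cong: measurable_cong_sets)
  interpret square_integrable_kernel ?S K C
  proof
    fix x :: 'a assume "x \<in> space ?S"
    then have "norm x = 1" by simp
    then show "(\<integral>\<^sup>+z. ennreal ((K (z, x))\<^sup>2) \<partial>?S) \<le> C"
      using nn_integral_sphere_sigma_inner_le[OF _ dim, of "\<lambda>t. ennreal ((g t)\<^sup>2)" x]
      by (simp add: C_def K_apply inner_commute)
  qed (use C K in simp_all)
  have inner_measurable: "(\<lambda>(x, y). x \<bullet> y) \<in> borel_measurable (?S \<Otimes>\<^sub>M ?S)"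
    using sphere_inner_kernel_measurable[of "\<lambda>t. t", where 'a='a] by (simp cong: measurable_cong_sets)
  \<comment> \<open>The zonal bound applied to the indicator of \<open>N\<close> has right-hand side
    0; this holds for every unit vector \<open>x\<close>.\<close>
  have N_slice: "AE z in ?S. x \<bullet> z \<notin> N" if x: "norm x = 1" for x :: 'a
  proof -
    have "AE t in lborel. t \<notin> N" by (rule AE_not_in[OF N])
    then have "(\<integral>\<^sup>+t. indicator N t * ennreal ((1 - t\<^sup>2) powr (real d / 2 - 1)) * indicator {-1..1} t \<partial>lborel) = 0"
      by (subst nn_integral_0_iff_AE) (auto elim!: eventually_mono)
    then have "(\<integral>\<^sup>+z. indicator N (x \<bullet> z) \<partial>?S) = 0"
      using nn_integral_sphere_sigma_inner_le[OF _ dim x, of "indicator N"] by simp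
    moreover have "(\<lambda>z. x \<bullet> z) \<in> borel_measurable ?S"
      using measurable_Pair2[OF inner_measurable, of x] x by simp
    then have "(\<lambda>z. indicator N (x \<bullet> z) :: ennreal) \<in> borel_measurable ?S"
      by measurable
    ultimately show ?thesis
      by (subst (asm) nn_integral_0_iff_AE) (auto elim!: eventually_mono simp: indicator_def)
  qed
  have f_eq_K: "f (x \<bullet> y) = K (x, y)" if "x \<in> unit_sphere" "y \<in> unit_sphere" "x \<bullet> y \<notin> N" for x y :: 'a
  proof -
    have "\<bar>x \<bullet> y\<bar> \<le> 1" using Cauchy_Schwarz_ineq2[of x y] that by simp
    then show ?thesis using fg that(3) by (simp add: K_apply abs_le_iff)
  qed
  define H where "H = (\<lambda>(x, y). LINT z|?S. K (z, x) * K (z, y))"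
  have H_measurable: "H \<in> borel_measurable (?S \<Otimes>\<^sub>M ?S)" unfolding H_def by measurable
  \<comment> \<open>For each pair the exceptional \<open>z\<close> form a null set, so
    \<open>F\<close> and \<open>H\<close> agree everywhere on the sphere. Agreement almost
    everywhere would not suffice, since the parts of \<mu> may charge null sets; joint measurability
    of \<open>F\<close> also follows from it.\<close>
  have F_eq_H: "F (x \<bullet> y) = H (x, y)" if x: "x \<in> unit_sphere" and y: "y \<in> unit_sphere" for x y :: 'a
  proof -
    have norm_x: "norm x = 1" and norm_y: "norm y = 1" using x y by simp_all
    have meas: "(\<lambda>z. K (z, x) * K (z, y)) \<in> borel_measurable ?S"
      using x y measurable_Pair1[OF K] by (intro borel_measurable_times) auto
    have "AE z in ?S. f (x \<bullet> z) * f (z \<bullet> y) = K (z, x) * K (z, y)"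
      using N_slice[OF norm_x] N_slice[OF norm_y] AE_space
    proof eventually_elim
      fix z assume z: "x \<bullet> z \<notin> N" "y \<bullet> z \<notin> N" "z \<in> space ?S"
      then show "f (x \<bullet> z) * f (z \<bullet> y) = K (z, x) * K (z, y)"
        using f_eq_K[of z x] f_eq_K[of z y] x y by (simp add: inner_commute)
    qed
    from integral_completion_AE[OF meas this] show ?thesis
      using F[OF x y] by (simp add: H_def)
  qed
  have "H \<in> borel_measurable (sphere_borel \<Otimes>\<^sub>M sphere_borel)"
    using H_measurable by (simp cong: measurable_cong_sets)
  also have "?this \<longleftrightarrow> ?meas"
    by (rule measurable_cong) (auto simp: space_pair_measure space_restrict_space F_eq_H)
  finally show F_measurable: ?meas .
  \<comment> \<open>For a given \<open>x\<close>, \<open>R\<close> may charge the set where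
    \<open>x \<bullet> y\<close> lies in \<open>N\<close>. As each \<open>y\<close> excludes only a
    null set of \<open>x\<close>, exchanging the quantifiers by Fubini shows that this happens only
    for a null set of \<open>x\<close>.\<close>
  have AE_slice: "AE x in ?S. AE y in R. x \<bullet> y \<notin> N"
    if R: "finite_measure R" and sets_R: "sets R = sets ?S" for R
  proof -
    interpret R: finite_measure R by (rule R)
    interpret T: pair_sigma_finite ?S R ..
    have space_R: "space R = unit_sphere" using sets_eq_imp_space_eq[OF sets_R] by simp
    have "(\<lambda>(x, y). x \<bullet> y) \<in> borel_measurable (?S \<Otimes>\<^sub>M R)"
      using inner_measurable sets_R by (simp cong: measurable_cong_sets sets_pair_measure_cong)
    then have "(\<lambda>(x, y). x \<bullet> y) -` (- N) \<inter> space (?S \<Otimes>\<^sub>M R) \<in> sets (?S \<Otimes>\<^sub>M R)"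
      by (rule measurable_sets) simp
    also have "(\<lambda>(x, y). x \<bullet> y) -` (- N) \<inter> space (?S \<Otimes>\<^sub>M R)
        = {w \<in> space (?S \<Otimes>\<^sub>M R). fst w \<bullet> snd w \<notin> N}" by auto
    finally have "(AE x in ?S. AE y in R. x \<bullet> y \<notin> N) \<longleftrightarrow> (AE y in R. AE x in ?S. x \<bullet> y \<notin> N)"
      by (rule T.AE_commute)
    moreover have "AE y in R. AE x in ?S. x \<bullet> y \<notin> N"
    proof (rule AE_I2)
      fix y assume "y \<in> space R"
      then have "norm y = 1" by (simp add: space_R)
      from N_slice[OF this] show "AE x in ?S. x \<bullet> y \<notin> N" by (simp add: inner_commute)
    qed
    ultimately show ?thesis by simp
  qed
  have slice_measurable: "(\<lambda>y. K (x, y)) \<in> borel_measurable R"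
    if "sets R = sets ?S" "x \<in> unit_sphere" for R x
    using measurable_Pair2[OF K, of x] that by (simp cong: measurable_cong_sets)
  have f_AE_eq_K: "AE y in R. f (x \<bullet> y) = K (x, y)"
    if "sets R = sets ?S" "x \<in> unit_sphere" "AE y in R. x \<bullet> y \<notin> N" for R x
    using that(3) AE_space
  proof eventually_elim
    fix y assume "x \<bullet> y \<notin> N" "y \<in> space R"
    then show "f (x \<bullet> y) = K (x, y)"
      using that(2) sets_eq_imp_space_eq[OF that(1)] by (intro f_eq_K) auto
  qed
  define P where "P = pos_variation sphere_borel \<mu>"
  define Q where "Q = neg_variation sphere_borel \<mu>"
  have P: "finite_measure P" "sets P = sets ?S" and Q: "finite_measure Q" "sets Q = sets ?S"
    using \<mu> by (simp_all add: P_def Q_def finite_measure_pos_variation finite_measure_neg_variation)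
  note S = S.finite_measure_axioms refl[of "sets ?S"]
  have mass': "measure P (space P) - measure Q (space Q) = 1"
    using jordan_decomposition[OF \<mu> sets.top] mass by (simp add: P_def Q_def space_restrict_space)
  define p where "p R z = (LINT y|R. K (z, y))" for R z
  define D where "D z = p P z - p Q z - p ?S z" for z
  have AE_integrable_K: "AE z in ?S. integrable R (\<lambda>y. K (z, y))"
    if R: "finite_measure R" "sets R = sets ?S" for R
  proof -
    interpret R: finite_measure R by (rule R)
    interpret T: pair_sigma_finite ?S R ..
    show ?thesis by (rule T.AE_integrable_fst'[OF integrable_kernel[OF R]])
  qed
  \<comment> \<open>Outside one common null set, \<open>f\<close> may be replaced by
    \<open>K\<close> for both Jordan parts and the surface measure, and all three slices are
    integrable.\<close>
  have AE_D: "AE z in ?S. signed_integrable sphere_borel \<mu> (\<lambda>y. f (z \<bullet> y)) \<and>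
      integrable (completion ?S) (\<lambda>y. f (z \<bullet> y)) \<and> discrepancy_at f \<mu> z = D z"
    using AE_slice[OF P] AE_slice[OF Q] AE_slice[OF S]
      AE_integrable_K[OF P] AE_integrable_K[OF Q] AE_integrable_K[OF S] AE_space
  proof eventually_elim
    case (elim z)
    then have z: "z \<in> unit_sphere" by simp
    note rep = integrable_completion_AE[OF slice_measurable[OF _ z] f_AE_eq_K[OF _ z]]
      integral_completion_AE[OF slice_measurable[OF _ z] f_AE_eq_K[OF _ z]]
    show ?case
      using elim rep[OF P(2) P(2)] rep[OF Q(2) Q(2)] rep[OF S(2) S(2)]
      by (simp add: signed_integrable_def discrepancy_at_def signed_integral_def D_def p_def
          P_def[symmetric] Q_def[symmetric])
  qed
  then show ?AE by (rule eventually_mono) simp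
  have p_measurable: "p R \<in> borel_measurable ?S" if R: "finite_measure R" "sets R = sets ?S" for R
  proof -
    interpret R: finite_measure R by (rule R)
    note [measurable_cong] = R(2)
    show ?thesis unfolding p_def by measurable
  qed
  note [measurable] = p_measurable[OF P] p_measurable[OF Q] p_measurable[OF S]
  have D_measurable: "(\<lambda>z. (D z)\<^sup>2) \<in> borel_measurable ?S" unfolding D_def by measurable
  \<comment> \<open>The \<open>L\<^sup>2\<close> pairing of potentials. Both the energies and the
    squared discrepancy expand into values of this symmetric form.\<close>
  define B where "B R R' = (LINT z|?S. p R z * p R' z)" for R R'
  note int = integrable_potential_product[folded p_def]
  have D_expand: "(D z)\<^sup>2 = p P z * p P z + p Q z * p Q z + p ?S z * p ?S z
      - 2 * (p P z * p Q z) - 2 * (p P z * p ?S z) + 2 * (p Q z * p ?S z)" for z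
    by (simp add: D_def power2_eq_square algebra_simps)
  have int_D: "integrable ?S (\<lambda>z. (D z)\<^sup>2)"
    unfolding D_expand
    by (intro Bochner_Integration.integrable_add Bochner_Integration.integrable_diff integrable_mult_right
        int P Q S)
  have D_integral: "(LINT z|?S. (D z)\<^sup>2) = B P P + B Q Q + B ?S ?S - 2 * B P Q - 2 * B P ?S + 2 * B Q ?S"
    unfolding D_expand B_def
    using int[OF P P] int[OF Q Q] int[OF S S] int[OF P Q] int[OF P S] int[OF Q S] by simp
  have AE_D2: "AE z in ?S. \<bar>discrepancy_at f \<mu> z\<bar>\<^sup>2 = (D z)\<^sup>2"
    using AE_D by (rule eventually_mono) simp
  show ?int
    using integrable_completion_AE[OF D_measurable AE_D2] int_D by (rule iffD2)
  have L2: "(L2_discrepancy f \<mu>)\<^sup>2 = (LINT z|?S. (D z)\<^sup>2)"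
    unfolding L2_discrepancy_def integral_completion_AE[OF D_measurable AE_D2]
    by (simp add: Bochner_Integration.integral_nonneg)
  obtain e :: 'a where e: "e \<in> Basis" using nonempty_Basis by blast
  define m where "m = p ?S e"
  \<comment> \<open>The law of \<open>u \<bullet> y\<close> under the surface measure is the same
    for all unit vectors \<open>u\<close>, so the choice of \<open>e\<close> is immaterial.\<close>
  have p_S: "p ?S x = m" if "x \<in> unit_sphere" for x
  proof -
    have "p ?S u = (LINT t|distr ?S borel (\<lambda>y. u \<bullet> y). g t)" if "u \<in> unit_sphere" for u
      unfolding p_def K_apply
      using measurable_Pair2[OF inner_measurable, of u] that
      by (intro integral_distr[symmetric]) simp_all
    then show ?thesis
      unfolding m_def using distr_sphere_sigma_inner[of x e] that e by simp
  qed
  have K_S: "(LINT z|?S. K (z, x)) = m" if "x \<in> unit_sphere" for x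
    using p_S[OF that] by (simp add: p_def K_apply inner_commute)
  \<comment> \<open>Pairing with the surface measure sees only the total mass: one factor
    \<open>m\<close> is the constant potential, the other comes from integrating \<open>K\<close>
    over its first variable after Fubini.\<close>
  have B_S: "B R ?S = m\<^sup>2 * measure R (space R)" if R: "finite_measure R" "sets R = sets ?S" for R
  proof -
    interpret R: finite_measure R by (rule R)
    interpret T: pair_sigma_finite ?S R ..
    have space_R: "space R = unit_sphere" using sets_eq_imp_space_eq[OF R(2)] by simp
    have "B R ?S = (LINT z|?S. p R z * m)"
      unfolding B_def by (rule Bochner_Integration.integral_cong) (simp_all add: p_S)
    also have "\<dots> = (LINT z|?S. p R z) * m" by simp
    also have "(LINT z|?S. p R z) = (LINT y|R. (LINT z|?S. K (z, y)))"
      unfolding p_def using T.Fubini_integral[of "\<lambda>z y. K (z, y)"] integrable_kernel[OF R] by simp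
    also have "\<dots> = (LINT y|R. m)"
      by (rule Bochner_Integration.integral_cong) (simp_all add: K_S space_R)
    finally show ?thesis by (simp add: power2_eq_square)
  qed
  have B_iterated: "(LINT y|R'. (LINT x|R. H (x, y))) = B R R'"
    if "finite_measure R" "sets R = sets ?S" "finite_measure R'" "sets R' = sets ?S" for R R'
    using integral_iterated_kernel[OF that] by (simp add: H_def B_def p_def)
  have H_slice: "(\<lambda>x. H (x, y)) \<in> borel_measurable ?S" if "y \<in> unit_sphere" for y
    using measurable_Pair1[OF H_measurable, of y] that by simp
  have H_int: "integrable R' (\<lambda>y. LINT x|R. H (x, y))"
    if R: "finite_measure R" "sets R = sets ?S" and R': "finite_measure R'" "sets R' = sets ?S" for R R'
  proof -
    interpret R: finite_measure R by (rule R)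
    interpret R': finite_measure R' by (rule R')
    interpret T: pair_sigma_finite R R' ..
    show ?thesis
      using T.integrable_snd[of "\<lambda>x y. H (x, y)"] integrable_iterated_kernel[OF R R'] by (simp add: H_def)
  qed
  have H_potential: "(\<lambda>y. LINT x|R. H (x, y)) \<in> borel_measurable ?S"
    if R: "finite_measure R" "sets R = sets ?S" for R
    using borel_measurable_integrable[OF H_int[OF R S]] .
  have sphere_space: "space (sphere_borel :: 'a measure) = unit_sphere" by (simp add: space_restrict_space)
  \<comment> \<open>Each of the two signed integrals splits into its Jordan parts, giving four
    pairings; the mixed ones carry a minus sign.\<close>
  have energy_\<mu>: "energy F \<mu> = B P P + B Q Q - B P Q - B Q P"
  proof -
    have "energy F \<mu> = signed_integral sphere_borel \<mu> (\<lambda>y. (LINT x|P. H (x, y)) - (LINT x|Q. H (x, y)))"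
      unfolding energy_def
    proof (rule signed_integral_cong)
      fix y :: 'a assume "y \<in> space sphere_borel"
      then have y: "y \<in> unit_sphere" by (simp add: sphere_space)
      have "signed_integral sphere_borel \<mu> (\<lambda>x. F (x \<bullet> y)) = signed_integral sphere_borel \<mu> (\<lambda>x. H (x, y))"
        using y by (intro signed_integral_cong) (simp add: sphere_space F_eq_H)
      also have "\<dots> = (LINT x|P. H (x, y)) - (LINT x|Q. H (x, y))"
        using H_slice[OF y] unfolding P_def Q_def
        by (intro signed_integral_borel) (simp cong: measurable_cong_sets)
      finally show "signed_integral sphere_borel \<mu> (\<lambda>x. F (x \<bullet> y)) = (LINT x|P. H (x, y)) - (LINT x|Q. H (x, y))" .
    qed
    also have "\<dots> = (LINT y|P. (LINT x|P. H (x, y)) - (LINT x|Q. H (x, y)))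
        - (LINT y|Q. (LINT x|P. H (x, y)) - (LINT x|Q. H (x, y)))"
      using borel_measurable_diff[OF H_potential[OF P] H_potential[OF Q]] unfolding P_def Q_def
      by (intro signed_integral_borel) (simp cong: measurable_cong_sets)
    also have "\<dots> = B P P + B Q Q - B P Q - B Q P"
      using H_int[OF P P] H_int[OF P Q] H_int[OF Q P] H_int[OF Q Q]
      by (simp add: B_iterated P Q)
    finally show ?thesis .
  qed
  have energy_\<sigma>: "energy F (measure ?S) = B ?S ?S"
  proof -
    have "energy F (measure ?S) = (LINT y|?S. (LINT x|?S. F (x \<bullet> y)))"
      by (rule energy_measure[OF S.finite_measure_axioms _ _ F_measurable]) simp_all
    also have "\<dots> = (LINT y|?S. (LINT x|?S. H (x, y)))"
      by (intro Bochner_Integration.integral_cong refl) (simp add: F_eq_H)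
    finally show ?thesis by (simp add: B_iterated S)
  qed
  have B_commute: "B Q P = B P Q" unfolding B_def by (simp add: mult.commute)
  have "B ?S ?S = m\<^sup>2" using B_S[OF S] S.prob_space by simp
  \<comment> \<open>Total mass 1 turns the cross terms of the squared discrepancy into
    \<open>- 2 * m\<^sup>2\<close>; with the term \<open>m\<^sup>2\<close> of the surface measure,
    \<open>- m\<^sup>2\<close> remains, which is minus its energy.\<close>
  moreover have "B P ?S - B Q ?S = m\<^sup>2"
  proof -
    have "B P ?S - B Q ?S = m\<^sup>2 * (measure P (space P) - measure Q (space Q))"
      by (simp only: B_S[OF P] B_S[OF Q] right_diff_distrib)
    then show ?thesis by (simp only: mass' mult_1_right)
  qed
  ultimately show ?eq
    unfolding L2 D_integral energy_\<mu> energy_\<sigma> B_commute by (simp add: algebra_simps)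
qed


section \<open>Point sets\<close>

text \<open>The empirical measure is the image of the uniform distribution on the indices, so
  repeated points are counted with multiplicity.\<close>

lemma sphere_empirical_measure:
  fixes z :: "nat \<Rightarrow> 'a::euclidean_space"
  assumes N: "N \<ge> 1" and z: "\<forall>i<N. z i \<in> unit_sphere"
  defines "R \<equiv> distr (uniform_count_measure {..<N}) sphere_borel z"
  shows "prob_space R"
    and "A \<in> sets sphere_borel \<Longrightarrow> empirical_measure N z A = measure R A"
    and "h \<in> borel_measurable sphere_borel \<Longrightarrow> (LINT x|R. h x) = (\<Sum>i<N. h (z i) :: real) / real N"
proof -
  let ?U = "uniform_count_measure {..<N}"
  have ne: "{..<N} \<noteq> {}" using N by (auto simp: lessThan_empty_iff)
  have z_measurable: "z \<in> measurable ?U sphere_borel"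
    using z by (auto simp: measurable_def space_uniform_count_measure sets_uniform_count_measure space_restrict_space)
  interpret U: prob_space ?U
    using ne by (intro prob_space_uniform_count_measure) simp
  show "prob_space R" unfolding R_def by (rule U.prob_space_distr[OF z_measurable])
  show "(LINT x|R. h x) = (\<Sum>i<N. h (z i)) / real N" if "h \<in> borel_measurable sphere_borel" for h :: "'a \<Rightarrow> real"
    unfolding R_def using that
    by (subst integral_distr[OF z_measurable]) (simp_all add: integral_uniform_count_measure)
  show "empirical_measure N z A = measure R A" if A: "A \<in> sets sphere_borel" for A
  proof -
    have "measure R A = measure ?U (z -` A \<inter> {..<N})"
      unfolding R_def by (simp add: measure_distr[OF z_measurable A] space_uniform_count_measure)
    also have "\<dots> = real (card (z -` A \<inter> {..<N})) / real N"
      by (subst measure_uniform_count_measure) simp_all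
    also have "real (card (z -` A \<inter> {..<N})) = (\<Sum>j<N. indicator A (z j))"
      by (simp add: indicator_def sum.If_cases Collect_conj_eq vimage_def Int_commute)
    finally show ?thesis by (simp add: empirical_measure_def)
  qed
qed

text \<open>The first two conclusions ensure that the integrals in the discrepancy are genuine and
  not the default value 0.\<close>

theorem theorem5p10:
  fixes d :: nat and l :: real and \<mu> :: "'a::euclidean_space set \<Rightarrow> real" and F f :: "real \<Rightarrow> real"
  assumes "d \<ge> 1" and "DIM('a) = d + 1" and "l = (real d - 1) / 2"
    and "finite_signed_measure sphere_borel \<mu>" and "\<mu> unit_sphere = 1"
    and "F \<in> posdef_class (unit_sphere :: 'a set)"
    and "f \<in> weighted_L2 l"
    and "\<And>x y :: 'a. x \<in> unit_sphere \<Longrightarrow> y \<in> unit_sphere \<Longrightarrow>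
           F (x \<bullet> y) = (LINT z|completion sphere_sigma. f (x \<bullet> z) * f (z \<bullet> y))"
  shows "(AE x in sphere_sigma.
            signed_integrable sphere_borel \<mu> (\<lambda>y. f (x \<bullet> y)) \<and>
            integrable (completion sphere_sigma) (\<lambda>y. f (x \<bullet> y))) \<and>
         integrable (completion sphere_sigma) (\<lambda>x. \<bar>discrepancy_at f \<mu> x\<bar>\<^sup>2) \<and>
         energy F \<mu> - energy F (measure (sphere_sigma :: 'a measure)) = (L2_discrepancy f \<mu>)\<^sup>2 \<and>
         (\<forall>N (z :: nat \<Rightarrow> 'a). N \<ge> 1 \<longrightarrow> (\<forall>i<N. z i \<in> unit_sphere) \<longrightarrow>
            1 / (real N)\<^sup>2 * (\<Sum>i<N. \<Sum>j<N. F (z i \<bullet> z j)) -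
              (LINT y|sphere_sigma. (LINT x|sphere_sigma. F ((x :: 'a) \<bullet> y)))
            = (point_discrepancy f N z)\<^sup>2)"
proof (intro conjI allI impI)
  have f: "f \<in> weighted_L2 ((real d - 1) / 2)" using assms(7) unfolding assms(3) .
  note \<mu> = assms(2,1,4,5) f assms(8)
  show "AE x in sphere_sigma. signed_integrable sphere_borel \<mu> (\<lambda>y. f (x \<bullet> y)) \<and>
      integrable (completion sphere_sigma) (\<lambda>y. f (x \<bullet> y))"
    by (rule AE_discrepancy_integrable[OF \<mu>])
  show "integrable (completion sphere_sigma) (\<lambda>x. \<bar>discrepancy_at f \<mu> x\<bar>\<^sup>2)"
    by (rule integrable_discrepancy_square[OF \<mu>])
  show "energy F \<mu> - energy F (measure (sphere_sigma :: 'a measure)) = (L2_discrepancy f \<mu>)\<^sup>2"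
    by (rule energy_eq_discrepancy[OF \<mu>])
  note F = energy_kernel_measurable[OF \<mu>]
  interpret S: prob_space "sphere_sigma :: 'a measure" by (rule prob_space_sphere_sigma)
  fix N and z :: "nat \<Rightarrow> 'a"
  assume N: "N \<ge> 1" and z: "\<forall>i<N. z i \<in> unit_sphere"
  define R where "R = distr (uniform_count_measure {..<N}) sphere_borel z"
  note R = sphere_empirical_measure[OF N z, folded R_def]
  interpret R: prob_space R by (rule R(1))
  have sets_R: "sets R = sets sphere_borel" by (simp add: R_def)
  have "finite_signed_measure sphere_borel (empirical_measure N z)"
    by (rule finite_signed_measure_measure[OF R.finite_measure_axioms sets_R]) (rule R(2))
  moreover have "empirical_measure N z unit_sphere = 1"
    using N z by (simp add: empirical_measure_def)
  ultimately have "energy F (empirical_measure N z) - energy F (measure (sphere_sigma :: 'a measure))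
      = (point_discrepancy f N z)\<^sup>2"
    unfolding point_discrepancy_def by (rule energy_eq_discrepancy[OF assms(2,1) _ _ f assms(8)])
  moreover have "energy F (measure (sphere_sigma :: 'a measure))
      = (LINT y|sphere_sigma. (LINT x|sphere_sigma. F ((x :: 'a) \<bullet> y)))"
    by (rule energy_measure[OF S.finite_measure_axioms _ _ F]) simp_all
  moreover have "energy F (empirical_measure N z) = 1 / (real N)\<^sup>2 * (\<Sum>i<N. \<Sum>j<N. F (z i \<bullet> z j))"
  proof -
    have slice: "(\<lambda>x. F (x \<bullet> y)) \<in> borel_measurable sphere_borel" if "y \<in> unit_sphere" for y :: 'a
      using measurable_Pair1[OF F, of y] that by (simp add: space_restrict_space)
    have "energy F (empirical_measure N z) = (LINT y|R. (LINT x|R. F (x \<bullet> y)))"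
      by (rule energy_measure[OF R.finite_measure_axioms sets_R _ F]) (rule R(2))
    also have "\<dots> = (LINT y|R. (\<Sum>i<N. F (y \<bullet> z i)) / real N)"
    proof (intro Bochner_Integration.integral_cong refl)
      fix y assume "y \<in> space R"
      then have y: "y \<in> unit_sphere"
        using sets_eq_imp_space_eq[OF sets_R] by (simp add: space_restrict_space)
      \<comment> \<open>Symmetry of the inner product puts \<open>y\<close> first, so that the
        double sum obtained has the shape of the claimed one up to renaming indices.\<close>
      show "(LINT x|R. F (x \<bullet> y)) = (\<Sum>i<N. F (y \<bullet> z i)) / real N"
        unfolding R(3)[OF slice[OF y]] by (simp add: inner_commute[of y])
    qed
    also have "\<dots> = (\<Sum>j<N. (\<Sum>i<N. F (z j \<bullet> z i)) / real N) / real N"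
      using slice z by (intro R(3) borel_measurable_divide borel_measurable_sum) auto
    finally show ?thesis
      by (simp add: sum_divide_distrib[symmetric] power2_eq_square)
  qed
  ultimately show "1 / (real N)\<^sup>2 * (\<Sum>i<N. \<Sum>j<N. F (z i \<bullet> z j)) -
      (LINT y|sphere_sigma. (LINT x|sphere_sigma. F ((x :: 'a) \<bullet> y))) = (point_discrepancy f N z)\<^sup>2"
    by simp
qed

end
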